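(* Let $P$ be a polytope of states which is the convex hull of a finite set of pure states, $$P = \mathrm{conv}\{|\psi_1\rangle\langle\psi_1|, \ldots, |\psi_m\rangle\langle\psi_m|\} \subseteq \mathcal D(\mathcal H_{d,n}).$$ Then there exists $\varepsilon^*>0$ such that the following holds. Let $\Psi = |\psi\rangle\langle\psi| \in \mathcal D(\mathcal H_{d,n})$ be a pure state with $d_P(\Psi) = \min_{\sigma\in P}T(\Psi,\sigma) = \varepsilon \le \varepsilon^*$. Given a partition $A\subseteq\{1,\ldots,n\}$, there exists a vertex $|\psi_j\rangle\langle\psi_j|$ of $P$ such that, for $\Psi_A = \mathrm{tr}_{\bar A}|\psi\rangle\langle\psi|$ and $\Psi_{j,A} = \mathrm{tr}_{\bar A}|\psi_j\rangle\langle\psi_j|$, $$|S(\Psi_A)-S(\Psi_{j,A})| \le f(\delta, d^n),$$ where $\delta = \varepsilon + 2\sqrt{1-h^{-1}[f(\varepsilon,d^n)]}$.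
   Context: $\mathcal H_{d,n} = (\mathbb C^d)^{\otimes n}$ with $d$ prime and $n\ge 1$, and $\mathcal D(\mathcal H_{d,n})$ is the set of density operators (positive semidefinite, trace one) on it. A pure state is a rank-one projector $|\psi\rangle\langle\psi|$ with $|\psi\rangle$ a unit vector. The trace distance is $T(\rho,\sigma) = \frac12\|\rho-\sigma\|$, where $\|B\| = \mathrm{Tr}\sqrt{B^\dagger B}$ is the trace norm. For $A\subseteq\{1,\ldots,n\}$, $\bar A$ is its complement and $\mathrm{tr}_{\bar A}$ is the partial trace over the tensor factors indexed by $\bar A$. $S(\rho) = -\mathrm{Tr}(\rho\log\rho)$ is the von Neumann entropy. All logarithms are base 2, with the convention $0\log 0=0$. The Fannes error is $$f(t,d^n) = t\log(d^n-1) + H[\{t,1-t\}],\qquad H[\{t,1-t\}] = -t\log t-(1-t)\log(1-t).$$ The binary entropy function is $h(x) = -x\log x-(1-x)\log(1-x)$. Its restriction to $[\frac12,1]$ is a strictly decreasing bijection onto $[0,1]$, and $h^{-1}:[0,1]\to[\frac12,1]$ denotes the inverse of this restriction. The displayed bound is understood to include that the quantities in it are well defined, i.e. $f(\varepsilon,d^n)\in[0,1]$ and $\delta\in[0,1]$ for the $\varepsilon$ considered. *)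

theory Defs
  imports
    "HOL-Computational_Algebra.Primes"
    "Jordan_Normal_Form.Schur_Decomposition"
begin

definition mat_trace :: "complex mat \<Rightarrow> complex" where
  "mat_trace A = (\<Sum>i<dim_row A. A $$ (i, i))"

definition ket_bra :: "complex vec \<Rightarrow> complex mat" where
  "ket_bra \<psi> = mat (dim_vec \<psi>) (dim_vec \<psi>) (\<lambda>(i, j). \<psi> $ i * cnj (\<psi> $ j))"

(* Functional calculus: a Hermitian A has a spectral decomposition A = U diag(l) U^* with U unitary
   and l real, and U diag(f(l)) U^* does not depend on the decomposition chosen.
   The value is unspecified if A is not Hermitian. *)
definition herm_fun :: "(real \<Rightarrow> real) \<Rightarrow> complex mat \<Rightarrow> complex mat" where
  "herm_fun f A = (SOME B. \<exists>U l.
     U \<in> carrier_mat (dim_row A) (dim_row A) \<and>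
     mat_adjoint U * U = 1\<^sub>m (dim_row A) \<and>
     A = U * mat_diag (dim_row A) (\<lambda>i. complex_of_real (l i)) * mat_adjoint U \<and>
     B = U * mat_diag (dim_row A) (\<lambda>i. complex_of_real (f (l i))) * mat_adjoint U)"

definition trace_norm :: "complex mat \<Rightarrow> real" where
  "trace_norm B = Re (mat_trace (herm_fun sqrt (mat_adjoint B * B)))"

definition trace_dist :: "complex mat \<Rightarrow> complex mat \<Rightarrow> real" where
  "trace_dist \<rho> \<sigma> = 1 / 2 * trace_norm (\<rho> - \<sigma>)"

(* The value of log 2 at 0 is irrelevant: on the kernel of \<rho> it is multiplied by 0,
   which is the convention 0 log 0 = 0. *)
definition vN_entropy :: "complex mat \<Rightarrow> real" where
  "vN_entropy \<rho> = - Re (mat_trace (\<rho> * herm_fun (log 2) \<rho>))"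

(* Operators on the n-fold tensor power of C^d are matrices of size d^n in the computational basis
   in Kronecker order: the basis vector |x_1> \<otimes> ... \<otimes> |x_n> with 0 \<le> x_k < d
   has index x_1 d^(n-1) + ... + x_n d^0, and site_digit d n k recovers x_k from that index. *)
definition site_digit :: "nat \<Rightarrow> nat \<Rightarrow> nat \<Rightarrow> nat \<Rightarrow> nat" where
  "site_digit d n k x = x div d ^ (n - k) mod d"

(* Index, in the basis of the tensor factors in A (ordered as in {1..n}), of the restriction to A
   of the basis vector with index x. *)
definition sub_index :: "nat \<Rightarrow> nat \<Rightarrow> nat set \<Rightarrow> nat \<Rightarrow> nat" where
  "sub_index d n A x = (\<Sum>k\<in>A. site_digit d n k x * d ^ card {l \<in> A. k < l})"

(* The reduced operator on the factors in A, for A a subset of {1..n}: the factors outside A are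
   traced out, <a| reduced_op \<rho> |b> being the sum of <a,c| \<rho> |b,c> over the basis vectors c of
   the other factors. *)
definition reduced_op :: "nat \<Rightarrow> nat \<Rightarrow> nat set \<Rightarrow> complex mat \<Rightarrow> complex mat" where
  "reduced_op d n A \<rho> = mat (d ^ card A) (d ^ card A) (\<lambda>(a, b).
     \<Sum>(x, y) \<in> {(x, y). x < d ^ n \<and> y < d ^ n \<and>
                       sub_index d n A x = a \<and> sub_index d n A y = b \<and>
                       (\<forall>k\<in>{1..n} - A. site_digit d n k x = site_digit d n k y)}.
       \<rho> $$ (x, y))"

(* Matrices do not form a type of class real_vector, so the library's convex hull and
   extreme_point_of are not available for them.  For finite V the next definition is
   convex_hull_finite, and is_vertex unfolds extreme_point_of. *)
definition mat_conv_hull :: "nat \<Rightarrow> complex mat set \<Rightarrow> complex mat set" where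
  "mat_conv_hull N V =
     {mat N N (\<lambda>(r, c). \<Sum>M\<in>V. complex_of_real (p M) * M $$ (r, c)) | p.
        (\<forall>M\<in>V. 0 \<le> p M) \<and> (\<Sum>M\<in>V. p M) = 1}"

definition is_vertex :: "complex mat \<Rightarrow> complex mat set \<Rightarrow> bool" where
  "is_vertex M P \<longleftrightarrow> M \<in> P \<and>
     \<not> (\<exists>X\<in>P. \<exists>Y\<in>P. \<exists>t. X \<noteq> Y \<and> 0 < t \<and> t < 1 \<and>
          M = complex_of_real (1 - t) \<cdot>\<^sub>m X + complex_of_real t \<cdot>\<^sub>m Y)"

(* For a polytope P (nonempty and compact) the infimum is a minimum. *)
definition dist_to :: "complex mat set \<Rightarrow> complex mat \<Rightarrow> real" where
  "dist_to P \<rho> = (INF \<sigma>\<in>P. trace_dist \<rho> \<sigma>)"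

definition binary_entropy :: "real \<Rightarrow> real" where
  "binary_entropy x = - x * log 2 x - (1 - x) * log 2 (1 - x)"

definition binary_entropy_inv :: "real \<Rightarrow> real" where
  "binary_entropy_inv = the_inv_into {1/2..1} binary_entropy"

definition fannes_error :: "real \<Rightarrow> real \<Rightarrow> real" where
  "fannes_error t D = t * log 2 (D - 1) + binary_entropy t"

end

theory Submission
  imports Defs "HOL-Analysis.L2_Norm" "Jordan_Normal_Form.Spectral_Radius"
begin

text \<open>If \<open>\<sigma> = \<Sum> p\<^sub>j |\<psi>\<^sub>j><\<psi>\<^sub>j|\<close> is at trace distance \<open>\<epsilon>\<close> from \<open>|\<psi>><\<psi>|\<close>, then \<open><\<psi>|\<sigma>|\<psi>> \<ge> 1 - \<epsilon>\<close>,
  hence \<open>|<\<psi>|\<psi>\<^sub>j>|\<^sup>2 \<ge> 1 - \<epsilon>\<close> for some \<open>j\<close>; every generator is a vertex, because pure states are extreme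
  among all states.  With a suitable phase, \<open>\<psi> - \<psi>\<^sub>j\<close> and \<open>\<psi> + \<psi>\<^sub>j\<close> have norms with product at most
  \<open>2 s\<close> for \<open>s = sqrt \<epsilon>\<close>.  Measuring the reduced states in an eigenbasis of one of them, and using that
  this increases the entropy of the other, reduces the comparison of entropies to that of two
  probability vectors at total variation distance at most \<open>s\<close>, whose entropies differ by at most
  \<open>- s log s + O(s)\<close>.  Since \<open>\<delta> \<ge> 2 s\<close>, the right-hand side \<open>f(\<delta>)\<close> is at least \<open>- 2 s log s - O(s)\<close>, which is
  larger when \<open>\<epsilon>\<close> is small: the sharp Fannes--Audenaert inequality is not needed.\<close>

section \<open>The entropy function\<close>

definition eta :: "real \<Rightarrow> real" where
  "eta x = - x * log 2 x"

lemma eta_0 [simp]: "eta 0 = 0" and eta_1 [simp]: "eta 1 = 0"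
  by (simp_all add: eta_def)

lemma eta_nonneg: "0 \<le> x \<Longrightarrow> x \<le> 1 \<Longrightarrow> 0 \<le> eta x"
  unfolding eta_def by (cases "x = 0") (auto simp: mult_nonneg_nonpos)

lemma has_real_derivative_eta:
  assumes "0 < x"
  shows "(eta has_real_derivative - (ln x + 1) / ln 2) (at x)"
  unfolding eta_def[abs_def] log_def using assms
  by (auto intro!: derivative_eq_intros simp: field_simps)

text \<open>Concavity: the right-hand side is the tangent to \<open>eta\<close> at \<open>a\<close>,
  evaluated at \<open>x\<close>. It is a cross-entropy term plus a linear term, and the linear terms
  cancel or add up to a constant when the bound is summed over probability vectors.\<close>

lemma eta_le_tangent:
  assumes "0 \<le> x" "0 < a"
  shows "eta x \<le> - x * log 2 a + (a - x) / ln 2"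
proof (cases "x = 0")
  case False
  then have x: "0 < x" using assms by simp
  have "ln (a / x) \<le> a / x - 1"
    using x assms by (intro ln_le_minus_one) simp
  then have "x * (ln a - ln x) \<le> a - x"
    using x assms by (simp add: ln_div field_simps)
  then have "(x * (ln a - ln x)) / ln 2 \<le> (a - x) / ln 2"
    by (intro divide_right_mono) auto
  then show ?thesis
    by (simp add: eta_def log_def algebra_simps diff_divide_distrib)
qed (use assms in simp)

text \<open>The logarithm is increasing, so \<open>log 2 (x + y)\<close> dominates both
  \<open>log 2 x\<close> and \<open>log 2 y\<close>.\<close>

lemma eta_add_le:
  assumes "0 \<le> x" "0 \<le> y"
  shows "eta (x + y) \<le> eta x + eta y"
proof (cases "x = 0 \<or> y = 0")
  case False
  then have "x * log 2 x \<le> x * log 2 (x + y)" "y * log 2 y \<le> y * log 2 (x + y)"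
    using assms by (auto intro!: mult_left_mono)
  then show ?thesis by (simp add: eta_def algebra_simps)
qed auto

text \<open>Supplies a vanishing majorant for the continuity of \<open>eta\<close> at 0. It comes
  from \<open>ln y \<le> y - 1\<close> at \<open>y = 1 / sqrt x\<close>.\<close>

lemma abs_eta_le_sqrt: 
  assumes "0 \<le> x" "x \<le> 1" shows "\<bar>eta x\<bar> \<le> 2 / ln 2 * sqrt x"
proof (cases "x = 0")
  case False
  then have x: "0 < x" using assms by simp
  have "ln (1 / sqrt x) \<le> 1 / sqrt x - 1"
    using x by (intro ln_le_minus_one) simp
  then have "- ln x \<le> 2 / sqrt x"
    using x by (simp add: ln_div ln_sqrt)
  then have "x * (- ln x) \<le> x * (2 / sqrt x)"
    using x by (intro mult_left_mono) auto
  also have "\<dots> = 2 * sqrt x" using x by (simp add: field_simps)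
  finally have "x * (- ln x) / ln 2 \<le> 2 * sqrt x / ln 2" by (intro divide_right_mono) auto
  then show ?thesis using eta_nonneg[OF assms] by (simp add: eta_def log_def)
qed simp

lemma continuous_on_eta: "continuous_on {0..1} eta"
  unfolding continuous_on_eq_continuous_within
proof
  fix x :: real assume x: "x \<in> {0..1}"
  show "continuous (at x within {0..1}) eta"
  proof (cases "x = 0")
    case True
    have "(sqrt \<longlongrightarrow> sqrt 0) (at 0 within {0..1})"
      by (intro tendsto_intros)
    then have "(sqrt \<longlongrightarrow> 0) (at 0 within {0..1})" by simp
    moreover have "\<forall>\<^sub>F x in at 0 within {0..1}. norm (eta x) \<le> norm (sqrt x) * (2 / ln 2)"
      unfolding eventually_at_filter using abs_eta_le_sqrt
      by (auto intro!: always_eventually simp: mult.commute)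
    ultimately have "(eta \<longlongrightarrow> 0) (at 0 within {0..1})"
      by (rule tendsto_0_le)
    then show ?thesis using True by (simp add: continuous_within)
  next
    case False
    then have "isCont eta x" using x unfolding eta_def by (intro continuous_intros) auto
    then show ?thesis by (rule continuous_at_imp_continuous_at_within)
  qed
qed

text \<open>Both halves of the total variation distance are at most \<open>s\<close>, but only the positive one
  contributes a term of order \<open>eta s\<close>.\<close>

lemma sum_eta_diff_le:
  fixes r m :: "nat \<Rightarrow> real"
  assumes r: "\<And>j. j < N \<Longrightarrow> 0 \<le> r j" and m: "\<And>j. j < N \<Longrightarrow> 0 \<le> m j"
    and sr: "(\<Sum>j<N. r j) = 1" and sm: "(\<Sum>j<N. m j) = 1"
    and tv: "(\<Sum>j<N. \<bar>r j - m j\<bar>) \<le> 2 * s" and s: "0 < s" "s \<le> 1"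
  shows "(\<Sum>j<N. eta (r j)) \<le> (\<Sum>j<N. eta (m j)) + eta s + N * s / ln 2"
proof -
  define q where "q j = max (r j - m j) 0" for j
  have ls: "log 2 s \<le> 0" using s by simp
  \<comment> \<open>One summand shape serves both signs of \<open>r j - m j\<close>: the linear
    parts cancel on summation because both vectors sum to 1, which leaves
    \<open>N * s / ln 2\<close>.\<close>
  have le: "eta (r j) - eta (m j) \<le> - q j * log 2 s + (s - (r j - m j)) / ln 2"
    if j: "j < N" for j
  proof (cases "m j \<le> r j")
    case True
    then have q: "q j = r j - m j" "0 \<le> q j" by (auto simp: q_def)
    \<comment> \<open>Subadditivity splits off the excess \<open>q j\<close>, which is then bounded
      by the tangent at \<open>s\<close>.\<close>
    have "eta (r j) \<le> eta (m j) + eta (q j)"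
      using eta_add_le[of "m j" "q j"] q m[OF j] by simp
    also have "eta (q j) \<le> - q j * log 2 s + (s - q j) / ln 2"
      by (rule eta_le_tangent) (use q s in auto)
    finally show ?thesis using q by simp
  next
    case False
    then have q: "q j = 0" and mj: "0 < m j" using r[OF j] by (auto simp: q_def)
    \<comment> \<open>Where \<open>r j\<close> lies below \<open>m j\<close> the tangent is taken at
      \<open>m j\<close>: as \<open>log 2 (m j) \<le> 0\<close>, the cross-entropy term is at most
      \<open>eta (m j)\<close>.\<close>
    have "m j \<le> 1"
      using member_le_sum[of j "{..<N}" m] j m sm by simp
    then have "log 2 (m j) \<le> 0" using mj by simp
    then have "- r j * log 2 (m j) \<le> eta (m j)"
      using False by (simp add: eta_def mult_right_mono_neg)
    moreover have "eta (r j) \<le> - r j * log 2 (m j) + (m j - r j) / ln 2"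
      by (rule eta_le_tangent) (use r[OF j] mj in auto)
    moreover have "(m j - r j) / ln 2 \<le> (s - (r j - m j)) / ln 2"
      using s by (intro divide_right_mono) auto
    ultimately show ?thesis using q by simp
  qed
  \<comment> \<open>Both vectors have the same sum, so the positive part carries half of the l1
    distance.\<close>
  have "2 * (\<Sum>j<N. q j) = (\<Sum>j<N. \<bar>r j - m j\<bar> + (r j - m j))"
    unfolding sum_distrib_left by (intro sum.cong) (auto simp: q_def max_def abs_if)
  also have "\<dots> \<le> 2 * s" using tv sr sm by (simp add: sum.distrib sum_subtractf)
  finally have "(\<Sum>j<N. q j) * (- log 2 s) \<le> s * (- log 2 s)"
    using ls by (intro mult_right_mono) auto
  moreover have "(\<Sum>j<N. eta (r j)) - (\<Sum>j<N. eta (m j)) \<le>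
      (\<Sum>j<N. - q j * log 2 s + (s - (r j - m j)) / ln 2)"
    unfolding sum_subtractf[symmetric] by (intro sum_mono le) auto
  moreover have "\<dots> = (\<Sum>j<N. q j) * (- log 2 s) + N * s / ln 2"
    using sr sm by (simp add: sum.distrib sum_subtractf sum_negf sum_divide_distrib[symmetric] sum_distrib_right[symmetric])
  ultimately show ?thesis by (simp add: eta_def)
qed

text \<open>Jensen's inequality: the tangent bounds at the mixed values \<open>a j\<close> are
  averaged with the weights \<open>p i j\<close>. Row sums recover the left-hand side, and column
  sums make the linear terms cancel.\<close>

lemma sum_eta_le_doubly_stochastic:
  fixes l :: "nat \<Rightarrow> real" and p :: "nat \<Rightarrow> nat \<Rightarrow> real"
  assumes p: "\<And>i j. i < N \<Longrightarrow> j < N \<Longrightarrow> 0 \<le> p i j"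
    and row: "\<And>i. i < N \<Longrightarrow> (\<Sum>j<N. p i j) = 1"
    and col: "\<And>j. j < N \<Longrightarrow> (\<Sum>i<N. p i j) = 1"
    and l: "\<And>i. i < N \<Longrightarrow> 0 \<le> l i"
  shows "(\<Sum>i<N. eta (l i)) \<le> (\<Sum>j<N. eta (\<Sum>i<N. p i j * l i))"
proof -
  define a where "a j = (\<Sum>i<N. p i j * l i)" for j
  have le: "p i j * eta (l i) \<le> p i j * (- l i * log 2 (a j) + (a j - l i) / ln 2)"
    if i: "i < N" and j: "j < N" for i j
  proof (cases "a j = 0")
    case True
    \<comment> \<open>There is no tangent at 0, but here \<open>p i j\<close> or \<open>l i\<close>
      vanishes, so both sides are 0.\<close>
    have "p i j * l i = 0"
      using True i j p l unfolding a_def by (subst (asm) sum_nonneg_eq_0_iff) auto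
    then show ?thesis using True by auto
  next
    case False
    have "0 \<le> a j" unfolding a_def using p l j by (intro sum_nonneg) auto
    then show ?thesis using False l[OF i] p[OF i j] by (intro mult_left_mono eta_le_tangent) auto
  qed
  have "(\<Sum>i<N. eta (l i)) = (\<Sum>i<N. \<Sum>j<N. p i j * eta (l i))"
    by (simp add: sum_distrib_right[symmetric] row)
  also have "\<dots> \<le> (\<Sum>i<N. \<Sum>j<N. p i j * (- l i * log 2 (a j) + (a j - l i) / ln 2))"
    by (intro sum_mono le) auto
  also have "\<dots> = (\<Sum>j<N. \<Sum>i<N. p i j * (- l i * log 2 (a j) + (a j - l i) / ln 2))"
    by (rule sum.swap)
  also have "\<dots> = (\<Sum>j<N. (\<Sum>i<N. p i j * l i) * (- log 2 (a j)) +
      (\<Sum>i<N. p i j) * a j / ln 2 - (\<Sum>i<N. p i j * l i) / ln 2)"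
    unfolding sum_distrib_right sum_divide_distrib
    by (simp add: sum.distrib[symmetric] sum_subtractf[symmetric] algebra_simps diff_divide_distrib add_divide_distrib)
  also have "\<dots> = (\<Sum>j<N. eta (a j))"
    by (intro sum.cong) (auto simp: col a_def[symmetric] eta_def)
  finally show ?thesis by (simp add: a_def)
qed

section \<open>Binary entropy and the Fannes error\<close>

lemma binary_entropy_eq: "binary_entropy x = eta x + eta (1 - x)"
  by (simp add: binary_entropy_def eta_def algebra_simps)

lemma binary_entropy_sym: "binary_entropy (1 - x) = binary_entropy x"
  by (simp add: binary_entropy_eq)

lemma binary_entropy_0 [simp]: "binary_entropy 0 = 0"
  and binary_entropy_1 [simp]: "binary_entropy 1 = 0"
  by (simp_all add: binary_entropy_eq)

lemma binary_entropy_half: "binary_entropy (1 / 2) = 1"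
  by (simp add: binary_entropy_def log_divide)

lemma continuous_on_binary_entropy: "continuous_on {0..1} binary_entropy"
proof -
  have "continuous_on {0..1} (\<lambda>x. eta x + eta (1 - x))"
    by (intro continuous_intros continuous_on_eta
        continuous_on_compose2[OF continuous_on_eta, of _ "\<lambda>x. 1 - x"]) auto
  then show ?thesis by (simp add: binary_entropy_eq)
qed

text \<open>The derivative is \<open>(ln (1 - z) - ln z) / ln 2\<close>, negative for z above 1/2.
  The open-interval form of the monotonicity rule copes with the endpoints 1/2 and 1, where the
  derivative is zero or infinite.\<close>

lemma binary_entropy_strict_decreasing:
  assumes "1 / 2 \<le> x" "x < y" "y \<le> 1"
  shows "binary_entropy y < binary_entropy x"
proof (rule DERIV_neg_imp_decreasing_open[OF \<open>x < y\<close>])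
  show "continuous_on {x..y} binary_entropy"
    by (rule continuous_on_subset[OF continuous_on_binary_entropy]) (use assms in auto)
  fix z assume z: "x < z" "z < y"
  then have z': "0 < z" "0 < 1 - z" "1 - z < z" using assms by auto
  have "((\<lambda>x. eta (1 - x)) has_real_derivative (- (ln (1 - z) + 1) / ln 2) * (- 1)) (at z)"
    by (rule DERIV_chain2[OF has_real_derivative_eta])
      (use z' in \<open>auto intro!: derivative_eq_intros\<close>)
  from DERIV_add[OF has_real_derivative_eta[OF z'(1)] this]
  have "(binary_entropy has_real_derivative (ln (1 - z) - ln z) / ln 2) (at z)"
    unfolding binary_entropy_eq[abs_def, symmetric]
    by (rule DERIV_cong) (simp add: field_simps)
  moreover have "(ln (1 - z) - ln z) / ln 2 < 0" using z' by (simp add: divide_neg_pos)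
  ultimately show "\<exists>d. (binary_entropy has_real_derivative d) (at z) \<and> d < 0" by blast
qed

lemma binary_entropy_mono:
  assumes "0 \<le> x" "x \<le> y" "y \<le> 1 / 2"
  shows "binary_entropy x \<le> binary_entropy y"
proof (cases "x = y")
  case False
  then show ?thesis
    using binary_entropy_strict_decreasing[of "1 - y" "1 - x"] assms
    by (simp add: binary_entropy_sym)
qed simp

text \<open>Strict decrease gives injectivity on \<open>{1/2..1}\<close> and the intermediate value
  theorem gives surjectivity onto \<open>{0..1}\<close>, so \<open>the_inv_into\<close> has its
  intended value at these \<open>y\<close>.\<close>

lemma binary_entropy_inv:
  assumes "0 \<le> y" "y \<le> 1"
  shows "1 / 2 \<le> binary_entropy_inv y" "binary_entropy_inv y \<le> 1"
    "binary_entropy (binary_entropy_inv y) = y"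
proof -
  have inj: "inj_on binary_entropy {1/2..1}"
    by (rule linorder_inj_onI)
       (use binary_entropy_strict_decreasing in \<open>auto simp: less_imp_neq[symmetric] dest!: less_imp_neq\<close>)
  have "\<exists>x\<ge>1/2. x \<le> 1 \<and> binary_entropy x = y"
    by (rule IVT2') (use assms continuous_on_subset[OF continuous_on_binary_entropy]
        in \<open>auto simp: binary_entropy_half\<close>)
  then have y: "y \<in> binary_entropy ` {1/2..1}" by auto
  show "binary_entropy (binary_entropy_inv y) = y"
    unfolding binary_entropy_inv_def by (rule f_the_inv_into_f[OF inj y])
  have "binary_entropy_inv y \<in> {1/2..1}"
    unfolding binary_entropy_inv_def by (rule the_inv_into_into[OF inj y order_refl])
  then show "1 / 2 \<le> binary_entropy_inv y" "binary_entropy_inv y \<le> 1" by auto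
qed

section \<open>The Fannes error near zero\<close>

lemma fannes_error_eventually_small:
  fixes D :: real
  assumes "0 < \<kappa>"
  shows "\<exists>\<epsilon>>0. \<forall>t. 0 \<le> t \<longrightarrow> t \<le> \<epsilon> \<longrightarrow> fannes_error t D < \<kappa>"
proof -
  have "continuous_on {0..1} (\<lambda>t. fannes_error t D)"
    unfolding fannes_error_def
    by (intro continuous_intros continuous_on_binary_entropy)
  then have "((\<lambda>t. fannes_error t D) \<longlongrightarrow> 0) (at 0 within {0..1})"
    by (auto simp: continuous_on_def fannes_error_def dest!: bspec[of _ _ 0])
  from order_tendstoD(2)[OF this assms] obtain r where r: "0 < r"
    "\<And>t. t \<in> {0..1} \<Longrightarrow> t \<noteq> 0 \<Longrightarrow> dist t 0 < r \<Longrightarrow> fannes_error t D < \<kappa>"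
    unfolding eventually_at by blast
  have "fannes_error t D < \<kappa>" if "0 \<le> t" "t \<le> min 1 (r / 2)" for t
    using r(2)[of t] that r(1) assms by (cases "t = 0") (auto simp: dist_real_def fannes_error_def)
  then show ?thesis using r(1) by (intro exI[of _ "min 1 (r / 2)"]) auto
qed

text \<open>Since \<open>h(1 - \<epsilon>) \<le> f(\<epsilon>)\<close>, the quantity \<open>\<delta>\<close> is at least \<open>2 s\<close> for \<open>s = sqrt \<epsilon>\<close>, and
  \<open>h(2 s)\<close> exceeds \<open>eta s\<close> by \<open>eta s - 2 s\<close>, which absorbs every term of order \<open>s\<close>.\<close>

lemma fannes_error_threshold:
  fixes D :: real
  assumes D: "2 \<le> D"
  shows "\<exists>\<epsilon>\<^sub>0. 0 < \<epsilon>\<^sub>0 \<and> \<epsilon>\<^sub>0 \<le> 1 \<and> (\<forall>\<epsilon> \<delta>. 0 \<le> \<epsilon> \<longrightarrow> \<epsilon> \<le> \<epsilon>\<^sub>0 \<longrightarrow>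
    \<delta> = \<epsilon> + 2 * sqrt (1 - binary_entropy_inv (fannes_error \<epsilon> D)) \<longrightarrow>
    fannes_error \<epsilon> D \<in> {0..1} \<and> \<delta> \<in> {0..1} \<and>
    eta (sqrt \<epsilon>) + D * sqrt \<epsilon> / ln 2 \<le> fannes_error \<delta> D)"
proof -
  have L: "0 \<le> log 2 (D - 1)" using D by simp
  \<comment> \<open>A Fannes error below \<open>binary_entropy (63 / 64)\<close> forces its inverse
    value to be at least 63/64, so the root term of \<open>\<delta>\<close> is at most 1/4. With
    \<open>\<epsilon> \<le> 1 / 16\<close> this keeps \<open>\<delta>\<close> below 1/2, where the
    binary entropy increases.\<close>
  have "binary_entropy 1 < binary_entropy (63 / 64)"
    by (rule binary_entropy_strict_decreasing) auto
  then have "0 < binary_entropy (63 / 64)" by simp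
  then obtain \<epsilon>\<^sub>1 where e1: "0 < \<epsilon>\<^sub>1"
    "\<And>t. 0 \<le> t \<Longrightarrow> t \<le> \<epsilon>\<^sub>1 \<Longrightarrow> fannes_error t D < binary_entropy (63 / 64)"
    using fannes_error_eventually_small by metis
  have h63: "binary_entropy (63 / 64) \<le> 1"
    using binary_entropy_strict_decreasing[of "1 / 2" "63 / 64"] by (simp add: binary_entropy_half)
  \<comment> \<open>Since \<open>eta (2 * s) = 2 * eta s - 2 * s\<close>, the required bound amounts
    to \<open>- log 2 s \<ge> D / ln 2 + 2\<close>, that is, to \<open>s \<le> b\<close>.\<close>
  define b where "b = 2 powr - (D / ln 2 + 2)"
  define \<epsilon>\<^sub>0 where "\<epsilon>\<^sub>0 = min \<epsilon>\<^sub>1 (min (1 / 16) (b\<^sup>2))"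
  have b: "0 < b" by (simp add: b_def)
  have "fannes_error \<epsilon> D \<in> {0..1} \<and> \<delta> \<in> {0..1} \<and>
    eta (sqrt \<epsilon>) + D * sqrt \<epsilon> / ln 2 \<le> fannes_error \<delta> D"
    if e: "0 \<le> \<epsilon>" "\<epsilon> \<le> \<epsilon>\<^sub>0"
      and d: "\<delta> = \<epsilon> + 2 * sqrt (1 - binary_entropy_inv (fannes_error \<epsilon> D))" for \<epsilon> \<delta>
  proof -
    have e': "\<epsilon> \<le> \<epsilon>\<^sub>1" "\<epsilon> \<le> 1 / 16" "\<epsilon> \<le> b\<^sup>2" using e(2) by (auto simp: \<epsilon>\<^sub>0_def)
    define x where "x = binary_entropy_inv (fannes_error \<epsilon> D)"
    have fh: "binary_entropy \<epsilon> \<le> fannes_error \<epsilon> D"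
      using L e by (simp add: fannes_error_def)
    have f0: "0 \<le> fannes_error \<epsilon> D"
      using fh binary_entropy_mono[of 0 \<epsilon>] e e' by simp
    have f1: "fannes_error \<epsilon> D < binary_entropy (63 / 64)" using e1(2) e e' by simp
    with h63 have f1': "fannes_error \<epsilon> D \<le> 1" by simp
    note x = binary_entropy_inv[OF f0 f1', folded x_def]
    \<comment> \<open>By symmetry \<open>binary_entropy (1 - \<epsilon>)\<close> is at most the
      Fannes error, which is \<open>binary_entropy x\<close>; monotonicity reverses the order of the
      arguments. This yields \<open>sqrt (1 - x) \<ge> s\<close>.\<close>
    have x1: "x \<le> 1 - \<epsilon>"
    proof (rule ccontr)
      assume "\<not> x \<le> 1 - \<epsilon>"
      then have "binary_entropy x < binary_entropy (1 - \<epsilon>)"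
        using e' x by (intro binary_entropy_strict_decreasing) auto
      then show False using fh x by (simp add: binary_entropy_sym)
    qed
    have x2: "63 / 64 \<le> x"
    proof (rule ccontr)
      assume "\<not> 63 / 64 \<le> x"
      then have "binary_entropy (63 / 64) < binary_entropy x"
        using x by (intro binary_entropy_strict_decreasing) auto
      then show False using f1 x by simp
    qed
    define s where "s = sqrt \<epsilon>"
    have s: "0 \<le> s" by (simp add: s_def e)
    have "s \<le> sqrt (1 - x)" using x1 by (simp add: s_def)
    then have d1: "2 * s \<le> \<delta>" using e by (simp add: d x_def)
    have "sqrt (1 - x) \<le> sqrt ((1 / 8)\<^sup>2)"
      using x2 by (subst real_sqrt_le_iff) (simp add: power2_eq_square)
    then have d2: "\<delta> \<le> 1 / 2" using e' by (simp add: d x_def)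
    have "eta s + D * s / ln 2 \<le> binary_entropy (2 * s)"
    proof (cases "s = 0")
      case False
      with s have s: "0 < s" by simp
      have "s \<le> b" using e' b by (simp add: s_def real_le_lsqrt)
      then have "log 2 s \<le> log 2 b" using s b by simp
      also have "log 2 b = - (D / ln 2 + 2)" by (simp add: b_def)
      finally have "s * (D / ln 2 + 2) \<le> s * (- log 2 s)" using s by (intro mult_left_mono) auto
      moreover have "eta (2 * s) = 2 * eta s - 2 * s"
        using s by (simp add: eta_def log_mult algebra_simps)
      moreover have "0 \<le> eta (1 - 2 * s)" using d1 d2 s by (intro eta_nonneg) auto
      ultimately show ?thesis by (simp add: binary_entropy_eq eta_def algebra_simps)
    qed simp
    also have "\<dots> \<le> binary_entropy \<delta>" using d1 d2 s by (intro binary_entropy_mono) auto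
    also have "\<dots> \<le> fannes_error \<delta> D" using L d1 s by (simp add: fannes_error_def)
    finally have "eta s + D * s / ln 2 \<le> fannes_error \<delta> D" .
    moreover have "0 \<le> \<delta>" "\<delta> \<le> 1" using d1 d2 s by auto
    ultimately show ?thesis using f0 f1' by (simp add: s_def)
  qed
  moreover have "0 < \<epsilon>\<^sub>0" "\<epsilon>\<^sub>0 \<le> 1" using e1 b by (auto simp: \<epsilon>\<^sub>0_def)
  ultimately show ?thesis by blast
qed

section \<open>Unitary matrices\<close>

lemma dim_mat_adjoint [simp]:
  "dim_row (mat_adjoint A) = dim_col A" "dim_col (mat_adjoint A) = dim_row A"
  by (auto simp: mat_adjoint_def)

lemma mat_adjoint_carrier [simp]:
  "A \<in> carrier_mat n m \<Longrightarrow> mat_adjoint A \<in> carrier_mat m n"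
  by auto

lemma index_mat_adjoint [simp]:
  fixes A :: "complex mat"
  assumes "i < dim_col A" "j < dim_row A"
  shows "mat_adjoint A $$ (i, j) = cnj (A $$ (j, i))"
  using assms by (simp add: mat_adjoint_def mat_of_rows_def)

lemma mat_adjoint_adjoint [simp]: "mat_adjoint (mat_adjoint A) = (A :: complex mat)"
  by (rule eq_matI) auto

lemma index_mult_sum:
  assumes "A \<in> carrier_mat n k" "B \<in> carrier_mat k m" "i < n" "j < m"
  shows "(A * B) $$ (i, j) = (\<Sum>l<k. A $$ (i, l) * B $$ (l, j))"
  using assms by (auto simp: scalar_prod_def lessThan_atLeast0 intro!: sum.cong)

lemma sum_rotate3:
  "(\<Sum>a\<in>A. \<Sum>b\<in>B. \<Sum>i\<in>C. f a b i) = (\<Sum>i\<in>C. \<Sum>a\<in>A. \<Sum>b\<in>B. f a b i)"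
proof -
  have "(\<Sum>a\<in>A. \<Sum>b\<in>B. \<Sum>i\<in>C. f a b i) = (\<Sum>a\<in>A. \<Sum>i\<in>C. \<Sum>b\<in>B. f a b i)"
    by (intro sum.cong refl sum.swap)
  then show ?thesis by (simp add: sum.swap[of _ A C])
qed

lemma mat_adjoint_mult:
  fixes A B :: "complex mat"
  assumes A: "A \<in> carrier_mat n k" and B: "B \<in> carrier_mat k m"
  shows "mat_adjoint (A * B) = mat_adjoint B * mat_adjoint A"
proof (rule eq_matI)
  fix i j assume "i < dim_row (mat_adjoint B * mat_adjoint A)" "j < dim_col (mat_adjoint B * mat_adjoint A)"
  then have ij: "i < m" "j < n" using A B by auto
  have "mat_adjoint (A * B) $$ (i, j) = cnj ((A * B) $$ (j, i))"
    using ij A B by (subst index_mat_adjoint) auto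
  also have "\<dots> = (\<Sum>l<k. cnj (A $$ (j, l)) * cnj (B $$ (l, i)))"
    using ij by (simp add: index_mult_sum[OF A B])
  also have "\<dots> = (\<Sum>l<k. mat_adjoint B $$ (i, l) * mat_adjoint A $$ (l, j))"
    using ij A B by (intro sum.cong) auto
  also have "\<dots> = (mat_adjoint B * mat_adjoint A) $$ (i, j)"
    using ij A B by (subst index_mult_sum[of _ m k _ n]) auto
  finally show "mat_adjoint (A * B) $$ (i, j) = (mat_adjoint B * mat_adjoint A) $$ (i, j)" .
qed (use A B in auto)

text \<open>The one-sided condition has the same form as the one inside \<open>herm_fun\<close>; for
  square matrices it yields the other side in \<open>unitary_mat_right\<close>.\<close>

definition unitary_mat :: "nat \<Rightarrow> complex mat \<Rightarrow> bool" where
  "unitary_mat N U \<longleftrightarrow> U \<in> carrier_mat N N \<and> mat_adjoint U * U = 1\<^sub>m N"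

lemma unitary_mat_right:
  assumes "unitary_mat N U" shows "U * mat_adjoint U = 1\<^sub>m N"
  using assms mat_mult_left_right_inverse[of "mat_adjoint U" N U]
  by (auto simp: unitary_mat_def)

lemma unitary_mat_adjoint: "unitary_mat N U \<Longrightarrow> unitary_mat N (mat_adjoint U)"
  using unitary_mat_right by (auto simp: unitary_mat_def)

lemma unitary_mat_mult:
  assumes U: "unitary_mat N U" and V: "unitary_mat N V"
  shows "unitary_mat N (U * V)"
proof -
  have c: "U \<in> carrier_mat N N" "V \<in> carrier_mat N N"
    using U V by (auto simp: unitary_mat_def)
  have "mat_adjoint (U * V) * (U * V) = mat_adjoint V * (mat_adjoint U * U) * V"
    using c by (simp add: mat_adjoint_mult[OF c] assoc_mult_mat[of _ N N _ N _ N]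
        mult_carrier_mat[of _ N N _ N])
  then show ?thesis using U V c by (simp add: unitary_mat_def)
qed

lemma unitary_mat_cols:
  assumes U: "unitary_mat N U" and ij: "i < N" "j < N"
  shows "(\<Sum>k<N. cnj (U $$ (k, i)) * U $$ (k, j)) = (if i = j then 1 else 0)"
proof -
  have c: "U \<in> carrier_mat N N" using U by (auto simp: unitary_mat_def)
  have "(mat_adjoint U * U) $$ (i, j) = (\<Sum>k<N. mat_adjoint U $$ (i, k) * U $$ (k, j))"
    using c ij by (intro index_mult_sum) auto
  also have "\<dots> = (\<Sum>k<N. cnj (U $$ (k, i)) * U $$ (k, j))"
    using c ij by (intro sum.cong) auto
  finally show ?thesis using U ij by (simp add: unitary_mat_def)
qed

lemma unitary_mat_col_norm:
  assumes "unitary_mat N U" "i < N"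
  shows "(\<Sum>k<N. (cmod (U $$ (k, i)))\<^sup>2) = 1"
proof -
  have "complex_of_real (\<Sum>k<N. (cmod (U $$ (k, i)))\<^sup>2) = 1"
    using unitary_mat_cols[OF assms(1) assms(2) assms(2)]
    by (simp add: complex_norm_square[symmetric] mult.commute del: of_real_power)
  then show ?thesis using of_real_eq_1_iff by blast
qed

lemma unitary_mat_row_norm:
  assumes "unitary_mat N U" "i < N"
  shows "(\<Sum>k<N. (cmod (U $$ (i, k)))\<^sup>2) = 1"
proof -
  have "U \<in> carrier_mat N N" using assms by (auto simp: unitary_mat_def)
  then show ?thesis
    using unitary_mat_col_norm[OF unitary_mat_adjoint[OF assms(1)] assms(2)] assms(2) by simp
qed

text \<open>Parseval's identity: the inner sums are the coordinates of \<open>z\<close> in the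
  orthonormal basis formed by the columns of \<open>U\<close>.\<close>

lemma unitary_mat_isometry:
  assumes U: "unitary_mat N U"
  shows "(\<Sum>j<N. (cmod (\<Sum>a<N. cnj (U $$ (a, j)) * z a))\<^sup>2) = (\<Sum>a<N. (cmod (z a))\<^sup>2)"
proof -
  have c: "U \<in> carrier_mat N N" using U by (auto simp: unitary_mat_def)
  have "complex_of_real (\<Sum>j<N. (cmod (\<Sum>a<N. cnj (U $$ (a, j)) * z a))\<^sup>2)
      = (\<Sum>j<N. \<Sum>a<N. \<Sum>b<N. z a * cnj (z b) * (cnj (U $$ (a, j)) * U $$ (b, j)))"
    by (simp add: complex_norm_square sum_product mult_ac del: of_real_power)
  also have "\<dots> = (\<Sum>a<N. \<Sum>b<N. \<Sum>j<N. z a * cnj (z b) * (cnj (U $$ (a, j)) * U $$ (b, j)))"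
    by (rule sum_rotate3[symmetric])
  also have "\<dots> = (\<Sum>a<N. \<Sum>b<N. z a * cnj (z b) * (if a = b then 1 else 0))"
  proof (intro sum.cong refl)
    fix a b assume "a \<in> {..<N}" "b \<in> {..<N}"
    then have ab: "a < N" "b < N" by auto
    \<comment> \<open>Orthonormality of the rows of \<open>U\<close> is read off from the columns of
      its adjoint.\<close>
    have "(\<Sum>j<N. cnj (U $$ (a, j)) * U $$ (b, j))
        = (\<Sum>j<N. cnj (mat_adjoint U $$ (j, b)) * mat_adjoint U $$ (j, a))"
      using c ab by (intro sum.cong) auto
    also have "\<dots> = (if a = b then 1 else 0)"
      using unitary_mat_cols[OF unitary_mat_adjoint[OF U] ab(2,1)] by auto
    finally show "(\<Sum>j<N. z a * cnj (z b) * (cnj (U $$ (a, j)) * U $$ (b, j)))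
        = z a * cnj (z b) * (if a = b then 1 else 0)"
      by (simp add: sum_distrib_left[symmetric])
  qed
  also have "\<dots> = complex_of_real (\<Sum>a<N. (cmod (z a))\<^sup>2)"
    by (simp add: complex_norm_square if_distrib[of "\<lambda>x. _ * x"] del: of_real_power cong: if_cong)
  finally show ?thesis using of_real_eq_iff by blast
qed

lemma index_spectral:
  assumes U: "U \<in> carrier_mat N N" and ab: "a < N" "b < N"
  shows "(U * mat_diag N g * mat_adjoint U) $$ (a, b)
    = (\<Sum>i<N. U $$ (a, i) * g i * cnj (U $$ (b, i)))"
proof -
  have "(U * mat_diag N g * mat_adjoint U) $$ (a, b)
      = (\<Sum>i<N. (U * mat_diag N g) $$ (a, i) * mat_adjoint U $$ (i, b))"
    using U ab by (intro index_mult_sum) auto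
  also have "\<dots> = (\<Sum>i<N. U $$ (a, i) * g i * cnj (U $$ (b, i)))"
    using U ab by (intro sum.cong) (auto simp: mat_diag_mult_right)
  finally show ?thesis .
qed

lemma mat_trace_spectral:
  assumes U: "unitary_mat N U"
  shows "mat_trace (U * mat_diag N g * mat_adjoint U) = (\<Sum>i<N. g i)"
proof -
  have c: "U \<in> carrier_mat N N" using U by (auto simp: unitary_mat_def)
  have "mat_trace (U * mat_diag N g * mat_adjoint U)
      = (\<Sum>a<N. \<Sum>i<N. g i * (cnj (U $$ (a, i)) * U $$ (a, i)))"
    using c index_spectral[OF c] by (simp add: mat_trace_def mult_ac del: index_mult_mat(1))
  also have "\<dots> = (\<Sum>i<N. \<Sum>a<N. g i * (cnj (U $$ (a, i)) * U $$ (a, i)))"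
    by (rule sum.swap)
  also have "\<dots> = (\<Sum>i<N. g i)"
    by (intro sum.cong) (auto simp: sum_distrib_left[symmetric] unitary_mat_cols[OF U])
  finally show ?thesis .
qed

text \<open>Expanding \<open>v\<close> in the eigenbasis makes the expectation value a combination
  of the eigenvalues, weighted by squared overlaps with the eigenvectors.\<close>

lemma quadratic_form_spectral:
  assumes U: "U \<in> carrier_mat N N"
  shows "(\<Sum>a<N. \<Sum>b<N. cnj (v a) *
      (U * mat_diag N (\<lambda>i. complex_of_real (l i)) * mat_adjoint U) $$ (a, b) * v b)
    = complex_of_real (\<Sum>i<N. (cmod (\<Sum>a<N. cnj (v a) * U $$ (a, i)))\<^sup>2 * l i)"
proof -
  have "(\<Sum>a<N. \<Sum>b<N. cnj (v a) *
      (U * mat_diag N (\<lambda>i. complex_of_real (l i)) * mat_adjoint U) $$ (a, b) * v b)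
    = (\<Sum>a<N. \<Sum>b<N. \<Sum>i<N. cnj (v a) * U $$ (a, i) * (v b * cnj (U $$ (b, i))) * l i)"
    using index_spectral[OF U] by (simp add: sum_distrib_left sum_distrib_right mult_ac)
  also have "\<dots> = (\<Sum>i<N. \<Sum>a<N. \<Sum>b<N. cnj (v a) * U $$ (a, i) * (v b * cnj (U $$ (b, i))) * l i)"
    by (rule sum_rotate3)
  also have "\<dots> = (\<Sum>i<N. (\<Sum>a<N. cnj (v a) * U $$ (a, i)) * (\<Sum>b<N. v b * cnj (U $$ (b, i))) * l i)"
    unfolding sum_product unfolding sum_distrib_right ..
  also have "\<dots> = complex_of_real (\<Sum>i<N. (cmod (\<Sum>a<N. cnj (v a) * U $$ (a, i)))\<^sup>2 * l i)"
    by (simp add: complex_norm_square del: of_real_power)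
  finally show ?thesis .
qed

section \<open>The spectral theorem for Hermitian matrices\<close>

text \<open>The Householder reflection along \<open>w = v - e\<^sub>0\<close>.\<close>

lemma unitary_with_first_col:
  fixes v :: "nat \<Rightarrow> complex"
  assumes v: "(\<Sum>i<Suc n. (cmod (v i))\<^sup>2) = 1" and v0: "v 0 = complex_of_real t" "t \<le> 0"
  shows "\<exists>H. unitary_mat (Suc n) H \<and> (\<forall>i<Suc n. H $$ (i, 0) = v i)"
proof -
  define w where "w i = (if i = 0 then v i - 1 else v i)" for i
  \<comment> \<open>The squared norm of \<open>w\<close> is \<open>2 * (1 - t)\<close>, so the
    coefficient is the usual Householder factor, 2 over that squared norm.\<close>
  define H where "H = mat (Suc n) (Suc n) (\<lambda>(i, j). (if i = j then 1 else 0) - w i * cnj (w j) / complex_of_real (1 - t))"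
  have t1: "complex_of_real (1 - t) \<noteq> 0" using v0 by (simp only: of_real_eq_0_iff)
  have H: "H \<in> carrier_mat (Suc n) (Suc n)" by (simp add: H_def)
  have "(\<Sum>i<Suc n. (cmod (w i))\<^sup>2) = (\<Sum>i<Suc n. (cmod (v i))\<^sup>2 + (if i = 0 then 1 - 2 * t else 0))"
    using v0 by (intro sum.cong) (auto simp: w_def cmod_def power2_eq_square algebra_simps)
  also have "\<dots> = 2 * (1 - t)" using v by (simp add: sum.distrib)
  finally have "complex_of_real (\<Sum>i<Suc n. (cmod (w i))\<^sup>2) = complex_of_real (2 * (1 - t))" by simp
  then have ww: "(\<Sum>i<Suc n. cnj (w i) * w i) = 2 * complex_of_real (1 - t)"
    by (simp add: complex_norm_square mult.commute del: of_real_power sum.lessThan_Suc)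
  have "mat_adjoint H * H = 1\<^sub>m (Suc n)"
  proof (rule eq_matI)
    fix i j assume "i < dim_row (1\<^sub>m (Suc n) :: complex mat)" "j < dim_col (1\<^sub>m (Suc n) :: complex mat)"
    then have ij: "i < Suc n" "j < Suc n" by auto
    let ?c = "complex_of_real (1 - t)"
    have "(mat_adjoint H * H) $$ (i, j) = (\<Sum>k<Suc n. mat_adjoint H $$ (i, k) * H $$ (k, j))"
      using H ij by (intro index_mult_sum) auto
    also have "\<dots> = (\<Sum>k<Suc n. ((if k = i then 1 else 0) - w i * cnj (w k) / ?c) *
        ((if k = j then 1 else 0) - w k * cnj (w j) / ?c))"
      using H ij by (intro sum.cong refl) (auto simp: H_def)
    also have "\<dots> = (\<Sum>k<Suc n. (if k = i then (if i = j then 1 else 0) else 0)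
        - (if k = i then w i * cnj (w j) / ?c else 0) - (if k = j then w i * cnj (w j) / ?c else 0)
        + (cnj (w k) * w k) * (w i * cnj (w j) / ?c\<^sup>2))"
      by (intro sum.cong refl) (auto simp: algebra_simps power2_eq_square)
    also have "\<dots> = (if i = j then 1 else 0) - 2 * (w i * cnj (w j) / ?c)
        + (\<Sum>k<Suc n. cnj (w k) * w k) * (w i * cnj (w j) / ?c\<^sup>2)"
      using ij by (simp add: sum.distrib sum_subtractf sum_distrib_right sum_divide_distrib del: sum.lessThan_Suc)
    \<comment> \<open>The quadratic term cancels the two cross terms, by the value \<open>ww\<close>
      of the squared norm.\<close>
    also have "\<dots> = (if i = j then 1 else 0)"
    proof -
      have "x - 2 * (z / c) + 2 * c * (z / c\<^sup>2) = x" if "c \<noteq> 0" for x z c :: complex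
        using that by (simp add: power2_eq_square)
      from this[OF t1] show ?thesis unfolding ww .
    qed
    finally show "(mat_adjoint H * H) $$ (i, j) = 1\<^sub>m (Suc n) $$ (i, j)" using ij by simp
  qed (use H in auto)
  moreover have "H $$ (i, 0) = v i" if i: "i < Suc n" for i
  proof -
    have "H $$ (i, 0) = (if i = 0 then 1 else 0) - w i * cnj (w 0) / complex_of_real (1 - t)"
      using i by (simp add: H_def)
    \<comment> \<open>The first entry of \<open>v\<close> being real matters here: it makes the
      reflection send the first basis vector to that vector plus \<open>w\<close>, which is
      \<open>v\<close>.\<close>
    also have "cnj (w 0) = - complex_of_real (1 - t)" using v0 by (simp add: w_def)
    also have "w i * - complex_of_real (1 - t) / complex_of_real (1 - t) = - w i"
      using t1 by (metis minus_divide_left mult_minus_right nonzero_mult_div_cancel_right)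
    finally show ?thesis by (auto simp: w_def)
  qed
  ultimately show ?thesis using H by (auto simp: unitary_mat_def)
qed

text \<open>Deflation by induction on the dimension: a unit eigenvector is completed to a unitary
  \<open>H\<close>, conjugation by \<open>H\<close> splits off its eigenvalue, and the remaining
  Hermitian block is diagonalised by the induction hypothesis.\<close>

lemma hermitian_spectral:
  fixes A :: "complex mat"
  assumes "A \<in> carrier_mat N N" "mat_adjoint A = A"
  shows "\<exists>U l. unitary_mat N U \<and> A = U * mat_diag N (\<lambda>i. complex_of_real (l i)) * mat_adjoint U"
  using assms
proof (induction N arbitrary: A)
  case 0
  then show ?case
    by (intro exI[of _ "1\<^sub>m 0"]) (auto simp: unitary_mat_def intro!: eq_matI)
next
  case (Suc n)
  let ?N = "Suc n"
  note A = Suc.prems(1)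
  obtain e where "eigenvalue A e"
    using spectrum_non_empty[OF A] by (auto simp: spectrum_def)
  then obtain u where u: "u \<in> carrier_vec ?N" "u \<noteq> 0\<^sub>v ?N" "A *\<^sub>v u = e \<cdot>\<^sub>v u"
    using A by (auto simp: eigenvalue_def eigenvector_def)
  obtain i where "i < ?N" "u $ i \<noteq> 0" using u by (metis carrier_vecD eq_vecI index_zero_vec)
  then have u0: "0 < (\<Sum>i<?N. (cmod (u $ i))\<^sup>2)"
    by (intro sum_pos2[of _ i]) auto
  define r where "r = sqrt (\<Sum>i<?N. (cmod (u $ i))\<^sup>2)"
  have r: "0 < r" using u0 by (simp add: r_def)
  \<comment> \<open>Scales \<open>u\<close> to unit length and turns its phase so that the first
    entry is real and at most 0, as the Householder construction requires.\<close>
  define c where "c = (if u $ 0 = 0 then 1 else - cnj (u $ 0) / cmod (u $ 0)) / r"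
  define v where "v i = c * u $ i" for i
  have cr: "(cmod c)\<^sup>2 = 1 / r\<^sup>2" using r by (simp add: c_def norm_divide power_divide)
  have "(\<Sum>i<?N. (cmod (v i))\<^sup>2) = (\<Sum>i<?N. (cmod (u $ i))\<^sup>2) / r\<^sup>2"
    by (simp add: v_def norm_mult power_mult_distrib cr sum_divide_distrib del: sum.lessThan_Suc)
  also have "\<dots> = 1" using u0 unfolding r_def by (subst real_sqrt_pow2) auto
  finally have v1: "(\<Sum>i<?N. (cmod (v i))\<^sup>2) = 1" .
  have v0: "v 0 = complex_of_real (- cmod (u $ 0) / r)"
    by (auto simp: v_def c_def field_simps complex_norm_square[symmetric] power2_eq_square[symmetric])
       (simp add: power2_eq_square)
  obtain H where H: "unitary_mat ?N H" and Hv: "\<And>i. i < ?N \<Longrightarrow> H $$ (i, 0) = v i"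
    using unitary_with_first_col[OF v1 v0] r by (auto simp: divide_le_0_iff)
  have Hc: "H \<in> carrier_mat ?N ?N" using H by (auto simp: unitary_mat_def)
  define B where "B = mat_adjoint H * A * H"
  have B: "B \<in> carrier_mat ?N ?N" using Hc A by (auto simp: B_def)
  have Bh: "mat_adjoint B = B"
    using Hc A Suc.prems(2) unfolding B_def
    by (simp add: mat_adjoint_mult[of _ ?N ?N _ ?N] assoc_mult_mat[of _ ?N ?N _ ?N _ ?N]
        mult_carrier_mat[of _ ?N ?N _ ?N])
  have AH: "(A * H) $$ (k, 0) = e * v k" if k: "k < ?N" for k
  proof -
    have "(A * H) $$ (k, 0) = (\<Sum>j<?N. A $$ (k, j) * H $$ (j, 0))"
      using k by (intro index_mult_sum[OF A Hc]) auto
    also have "\<dots> = c * (\<Sum>j<?N. A $$ (k, j) * u $ j)"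
      unfolding sum_distrib_left by (intro sum.cong) (auto simp: Hv v_def)
    also have "(\<Sum>j<?N. A $$ (k, j) * u $ j) = (A *\<^sub>v u) $ k"
      using k A u(1) by (auto simp: scalar_prod_def lessThan_atLeast0 intro!: sum.cong)
    finally show ?thesis using k u by (simp add: v_def)
  qed
  have B0: "B $$ (i, 0) = (if i = 0 then e else 0)" if i: "i < ?N" for i
  proof -
    have "B $$ (i, 0) = (mat_adjoint H * (A * H)) $$ (i, 0)"
      using Hc A by (simp add: B_def assoc_mult_mat[of _ ?N ?N _ ?N _ ?N])
    also have "\<dots> = (\<Sum>k<?N. mat_adjoint H $$ (i, k) * (A * H) $$ (k, 0))"
      using Hc A i by (intro index_mult_sum) auto
    also have "\<dots> = (\<Sum>k<?N. e * (cnj (H $$ (k, i)) * H $$ (k, 0)))"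
      using Hc i by (intro sum.cong refl) (auto simp: AH Hv)
    also have "\<dots> = (if i = 0 then e else 0)"
      unfolding sum_distrib_left[symmetric] using unitary_mat_cols[OF H i, of 0] by auto
    finally show ?thesis .
  qed
  have Bij: "B $$ (i, j) = cnj (B $$ (j, i))" if "i < ?N" "j < ?N" for i j
    using that B arg_cong[OF Bh, of "\<lambda>M. M $$ (i, j)"] by auto
  \<comment> \<open>The diagonal entries of a Hermitian matrix are real; the same symmetry later
    clears the rest of the first row of \<open>B\<close>.\<close>
  have e: "complex_of_real (Re e) = e"
    using Bij[of 0 0] B0[of 0] by (simp add: complex_eq_iff)
  define A' where "A' = mat n n (\<lambda>(i, j). B $$ (Suc i, Suc j))"
  have "A' \<in> carrier_mat n n" by (simp add: A'_def)
  moreover have "mat_adjoint A' = A'"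
    by (rule eq_matI) (auto simp: A'_def Bij[symmetric])
  ultimately obtain U l where U: "unitary_mat n U"
    and Ul: "A' = U * mat_diag n (\<lambda>i. complex_of_real (l i)) * mat_adjoint U"
    using Suc.IH by blast
  have Uc: "U \<in> carrier_mat n n" using U by (auto simp: unitary_mat_def)
  \<comment> \<open>The block sum of the 1 by 1 identity and \<open>U\<close>; \<open>m\<close>
    accordingly puts the split-off eigenvalue in front of \<open>l\<close>.\<close>
  define V where "V = mat ?N ?N (\<lambda>(i, j). case (i, j) of (0, 0) \<Rightarrow> 1 | (Suc i, Suc j) \<Rightarrow> U $$ (i, j) | _ \<Rightarrow> 0)"
  define m where "m i = (case i of 0 \<Rightarrow> Re e | Suc i \<Rightarrow> l i)" for i
  have V: "V \<in> carrier_mat ?N ?N" by (simp add: V_def)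
  have Vu: "unitary_mat ?N V"
    unfolding unitary_mat_def
  proof (intro conjI V eq_matI)
    fix i j assume "i < dim_row (1\<^sub>m ?N :: complex mat)" "j < dim_col (1\<^sub>m ?N :: complex mat)"
    then have ij: "i < ?N" "j < ?N" by auto
    have "(mat_adjoint V * V) $$ (i, j) = (\<Sum>k<?N. mat_adjoint V $$ (i, k) * V $$ (k, j))"
      using V ij by (intro index_mult_sum) auto
    also have "\<dots> = (\<Sum>k<?N. cnj (V $$ (k, i)) * V $$ (k, j))"
      using V ij by (intro sum.cong refl) auto
    also have "\<dots> = (if i = j then 1 else 0)"
      using ij unitary_mat_cols[OF U, of "i - 1" "j - 1"]
      by (auto simp: V_def sum.lessThan_Suc_shift split: nat.splits simp del: sum.lessThan_Suc)
    finally show "(mat_adjoint V * V) $$ (i, j) = 1\<^sub>m ?N $$ (i, j)" using ij by simp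
  qed (use V in auto)
  have BV: "B = V * mat_diag ?N (\<lambda>i. complex_of_real (m i)) * mat_adjoint V"
  proof (rule eq_matI)
    fix i j assume "i < dim_row (V * mat_diag ?N (\<lambda>i. complex_of_real (m i)) * mat_adjoint V)"
      "j < dim_col (V * mat_diag ?N (\<lambda>i. complex_of_real (m i)) * mat_adjoint V)"
    then have ij: "i < ?N" "j < ?N" using V by auto
    have BS: "B $$ (Suc i, Suc j) = (\<Sum>k<n. U $$ (i, k) * l k * cnj (U $$ (j, k)))"
      if "i < n" "j < n" for i j
      using index_spectral[OF Uc that, of "\<lambda>i. complex_of_real (l i)"] that
      unfolding Ul[symmetric] by (simp add: A'_def)
    have B0': "B $$ (0, j) = (if j = 0 then e else 0)" if "j < ?N" for j
      using Bij[of 0 j] B0[OF that] that e by (auto simp: complex_eq_iff)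
    show "B $$ (i, j) = (V * mat_diag ?N (\<lambda>i. complex_of_real (m i)) * mat_adjoint V) $$ (i, j)"
      unfolding index_spectral[OF V ij] using ij e B0 B0' BS
      by (auto simp: V_def m_def sum.lessThan_Suc_shift split: nat.splits simp del: sum.lessThan_Suc)
  qed (use V B in auto)
  have "A = (H * mat_adjoint H) * A * (H * mat_adjoint H)"
    using A by (simp add: unitary_mat_right[OF H])
  also have "\<dots> = H * B * mat_adjoint H"
    using A Hc unfolding B_def
    by (simp add: assoc_mult_mat[of _ ?N ?N _ ?N _ ?N] mult_carrier_mat[of _ ?N ?N _ ?N])
  also have "\<dots> = (H * V) * mat_diag ?N (\<lambda>i. complex_of_real (m i)) * mat_adjoint (H * V)"
    unfolding BV using V Hc mat_diag_dim[of ?N]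
    by (simp add: mat_adjoint_mult[of _ ?N ?N _ ?N] assoc_mult_mat[of _ ?N ?N _ ?N _ ?N]
        mult_carrier_mat[of _ ?N ?N _ ?N])
  finally show ?case using unitary_mat_mult[OF H Vu] by blast
qed

section \<open>Entropy and trace norm\<close>

text \<open>The spectral theorem makes the description under \<open>SOME\<close> satisfiable. The
  chosen value thus comes with one decomposition shared by \<open>A\<close> and
  \<open>herm_fun f A\<close>, through which the later proofs reach \<open>herm_fun\<close>.\<close>

lemma herm_fun_spectral:
  assumes "A \<in> carrier_mat N N" "mat_adjoint A = A"
  shows "\<exists>U l. unitary_mat N U \<and> A = U * mat_diag N (\<lambda>i. complex_of_real (l i)) * mat_adjoint U \<and>
    herm_fun f A = U * mat_diag N (\<lambda>i. complex_of_real (f (l i))) * mat_adjoint U"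
proof -
  have "dim_row A = N" using assms by simp
  then show ?thesis
    unfolding herm_fun_def unitary_mat_def
    using hermitian_spectral[OF assms, unfolded unitary_mat_def] by (smt (verit) someI_ex)
qed

text \<open>The state and its logarithm are diagonal in the same basis, so the eigenvalues multiply
  and the trace adds them up.\<close>

lemma vN_entropy_spectral:
  assumes "\<rho> \<in> carrier_mat N N" "mat_adjoint \<rho> = \<rho>"
  shows "\<exists>U l. unitary_mat N U \<and> \<rho> = U * mat_diag N (\<lambda>i. complex_of_real (l i)) * mat_adjoint U \<and>
    vN_entropy \<rho> = (\<Sum>i<N. eta (l i))"
proof -
  obtain U l where U: "unitary_mat N U"
    and r: "\<rho> = U * mat_diag N (\<lambda>i. complex_of_real (l i)) * mat_adjoint U"
    and h: "herm_fun (log 2) \<rho> = U * mat_diag N (\<lambda>i. complex_of_real (log 2 (l i))) * mat_adjoint U"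
    using herm_fun_spectral[OF assms] by blast
  have c: "U \<in> carrier_mat N N" using U by (simp add: unitary_mat_def)
  let ?D = "\<lambda>f. mat_diag N (\<lambda>i. complex_of_real (f i))"
  have "\<rho> * herm_fun (log 2) \<rho> =
      U * (?D l * (mat_adjoint U * U) * ?D (\<lambda>i. log 2 (l i))) * mat_adjoint U"
    unfolding h by (subst r) (use c in \<open>simp add: assoc_mult_mat[of _ N N _ N _ N] mult_carrier_mat[of _ N N _ N]
      del: mat_diag_diag\<close>)
  also have "\<dots> = U * mat_diag N (\<lambda>i. complex_of_real (l i * log 2 (l i))) * mat_adjoint U"
    using U by (simp add: unitary_mat_def right_mult_one_mat[OF mat_diag_dim])
  finally have "vN_entropy \<rho> = (\<Sum>i<N. eta (l i))"
    unfolding vN_entropy_def by (simp only: mat_trace_spectral[OF U]) (simp add: eta_def sum_negf)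
  then show ?thesis using U r by blast
qed

section \<open>Trace duality for the trace norm\<close>

lemma Re_sum_cnj_mult_le:
  "Re (\<Sum>k\<in>K. cnj (f k) * g k) \<le> L2_set (\<lambda>k. cmod (f k)) K * L2_set (\<lambda>k. cmod (g k)) K"
proof -
  have "Re (\<Sum>k\<in>K. cnj (f k) * g k) \<le> (\<Sum>k\<in>K. cmod (cnj (f k) * g k))"
    using complex_Re_le_cmod norm_sum by (rule order_trans)
  also have "\<dots> = (\<Sum>k\<in>K. \<bar>cmod (f k)\<bar> * \<bar>cmod (g k)\<bar>)" by (simp add: norm_mult)
  also have "\<dots> \<le> L2_set (\<lambda>k. cmod (f k)) K * L2_set (\<lambda>k. cmod (g k)) K"
    by (rule L2_set_mult_ineq)
  finally show ?thesis .
qed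

lemma mat_trace_mult_commute:
  assumes "A \<in> carrier_mat n m" "B \<in> carrier_mat m n"
  shows "mat_trace (A * B) = mat_trace (B * A)"
proof -
  have "mat_trace (A * B) = (\<Sum>i<n. \<Sum>j<m. A $$ (i, j) * B $$ (j, i))"
    using assms by (simp add: mat_trace_def index_mult_sum[OF assms] del: index_mult_mat(1))
  also have "\<dots> = (\<Sum>j<m. \<Sum>i<n. B $$ (j, i) * A $$ (i, j))"
    by (subst sum.swap) (simp add: mult.commute)
  also have "\<dots> = mat_trace (B * A)"
    using assms by (simp add: mat_trace_def index_mult_sum[OF assms(2,1)] del: index_mult_mat(1))
  finally show ?thesis .
qed

text \<open>If \<open>U\<close> diagonalises \<open>mat_adjoint B * B\<close> with eigenvalues
  \<open>l i\<close>, then column i of \<open>W * B * U\<close> has squared norm \<open>l i\<close>.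
  Cauchy-Schwarz against the unit columns of \<open>U\<close> bounds the trace by the sum of the
  \<open>sqrt (l i)\<close>.\<close>

lemma Re_trace_unitary_le_trace_norm:
  assumes W: "unitary_mat N W" and B: "B \<in> carrier_mat N N"
  shows "Re (mat_trace (W * B)) \<le> trace_norm B"
proof -
  have "mat_adjoint (mat_adjoint B * B) = mat_adjoint B * B"
    using B by (simp add: mat_adjoint_mult[of _ N N _ N])
  moreover have "mat_adjoint B * B \<in> carrier_mat N N" using B by auto
  ultimately obtain U l where U: "unitary_mat N U"
    and BB: "mat_adjoint B * B = U * mat_diag N (\<lambda>i. complex_of_real (l i)) * mat_adjoint U"
    and h: "herm_fun sqrt (mat_adjoint B * B) = U * mat_diag N (\<lambda>i. complex_of_real (sqrt (l i))) * mat_adjoint U"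
    using herm_fun_spectral by blast
  have c: "U \<in> carrier_mat N N" "W \<in> carrier_mat N N" using U W by (auto simp: unitary_mat_def)
  note assoc = assoc_mult_mat[of _ N N _ N _ N] mult_carrier_mat[of _ N N _ N]
  define M where "M = W * B * U"
  have M: "M \<in> carrier_mat N N" using c B by (simp add: M_def assoc)
  \<comment> \<open>The unitary \<open>W\<close> cancels, leaving the diagonalisation of
    \<open>mat_adjoint B * B\<close>.\<close>
  have "mat_adjoint M * M = mat_adjoint U * (mat_adjoint B * (mat_adjoint W * W) * B) * U"
    using c B unfolding M_def by (simp add: mat_adjoint_mult[of _ N N _ N] assoc)
  also have "\<dots> = mat_adjoint U * (mat_adjoint B * B) * U"
    using W c B by (simp add: unitary_mat_def)
  also have "\<dots> = (mat_adjoint U * U) * mat_diag N (\<lambda>i. complex_of_real (l i)) * (mat_adjoint U * U)"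
    unfolding BB using c by (simp add: assoc)
  also have "\<dots> = mat_diag N (\<lambda>i. complex_of_real (l i))"
    using U by (simp add: unitary_mat_def left_mult_one_mat[OF mat_diag_dim] right_mult_one_mat[OF mat_diag_dim])
  finally have MM: "mat_adjoint M * M = mat_diag N (\<lambda>i. complex_of_real (l i))" .
  have col: "(\<Sum>k<N. (cmod (M $$ (k, i)))\<^sup>2) = l i" if i: "i < N" for i
  proof -
    have "complex_of_real (\<Sum>k<N. (cmod (M $$ (k, i)))\<^sup>2) = (\<Sum>k<N. mat_adjoint M $$ (i, k) * M $$ (k, i))"
      using M i by (simp add: complex_norm_square mult.commute del: of_real_power)
    also have "\<dots> = (mat_adjoint M * M) $$ (i, i)"
      using M i by (intro index_mult_sum[symmetric]) auto
    also have "\<dots> = complex_of_real (l i)" unfolding MM using i by (simp add: mat_diag_def)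
    finally show ?thesis using of_real_eq_iff by blast
  qed
  have "W * B = M * mat_adjoint U"
    using c B unitary_mat_right[OF U] by (simp add: M_def assoc)
  then have "mat_trace (W * B) = mat_trace (mat_adjoint U * M)"
    using mat_trace_mult_commute[of M N N "mat_adjoint U"] M c by simp
  also have "\<dots> = (\<Sum>i<N. \<Sum>k<N. cnj (U $$ (k, i)) * M $$ (k, i))"
    using c M by (simp add: mat_trace_def index_mult_sum[of _ N N _ N] del: index_mult_mat(1))
  finally have "Re (mat_trace (W * B)) = (\<Sum>i<N. Re (\<Sum>k<N. cnj (U $$ (k, i)) * M $$ (k, i)))"
    by (simp only: Re_sum)
  also have "\<dots> \<le> (\<Sum>i<N. L2_set (\<lambda>k. cmod (U $$ (k, i))) {..<N} * L2_set (\<lambda>k. cmod (M $$ (k, i))) {..<N})"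
    by (intro sum_mono Re_sum_cnj_mult_le)
  also have "\<dots> = (\<Sum>i<N. sqrt (l i))"
    by (intro sum.cong) (auto simp: L2_set_def col unitary_mat_col_norm[OF U])
  also have "\<dots> = trace_norm B"
    unfolding trace_norm_def h mat_trace_spectral[OF U] by simp
  finally show ?thesis .
qed

section \<open>Measured distributions and entropies of Gram matrices\<close>

lemma sum_abs_diff_norm_sq_le:
  fixes f g :: "'i \<Rightarrow> complex"
  shows "(\<Sum>i\<in>I. \<bar>(cmod (f i))\<^sup>2 - (cmod (g i))\<^sup>2\<bar>)
    \<le> sqrt (\<Sum>i\<in>I. (cmod (f i - g i))\<^sup>2) * sqrt (\<Sum>i\<in>I. (cmod (f i + g i))\<^sup>2)"
proof -
  have "\<bar>(cmod x)\<^sup>2 - (cmod y)\<^sup>2\<bar> \<le> \<bar>cmod (x - y)\<bar> * \<bar>cmod (x + y)\<bar>" for x y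
  proof -
    \<comment> \<open>Factoring the difference of squares produces the difference and the sum of the
      amplitudes, to which Cauchy-Schwarz is then applied.\<close>
    have "(cmod x)\<^sup>2 - (cmod y)\<^sup>2 = Re ((x - y) * cnj (x + y))"
      unfolding cmod_power2 by (simp add: algebra_simps power2_eq_square)
    also have "\<bar>\<dots>\<bar> \<le> cmod ((x - y) * cnj (x + y))" by (rule abs_Re_le_cmod)
    finally show ?thesis by (simp only: norm_mult complex_mod_cnj abs_norm_cancel)
  qed
  then have "(\<Sum>i\<in>I. \<bar>(cmod (f i))\<^sup>2 - (cmod (g i))\<^sup>2\<bar>)
      \<le> (\<Sum>i\<in>I. \<bar>cmod (f i - g i)\<bar> * \<bar>cmod (f i + g i)\<bar>)" by (intro sum_mono)
  also have "\<dots> \<le> L2_set (\<lambda>i. cmod (f i - g i)) I * L2_set (\<lambda>i. cmod (f i + g i)) I"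
    by (rule L2_set_mult_ineq)
  finally show ?thesis by (simp add: L2_set_def)
qed

text \<open>If \<open>X a c\<close> is the amplitude of system state \<open>a\<close> with
  environment state \<open>c\<close>, this is the reduced state of the system, the product of
  \<open>X\<close> with its adjoint.\<close>

definition gram_mat :: "nat \<Rightarrow> 'c set \<Rightarrow> (nat \<Rightarrow> 'c \<Rightarrow> complex) \<Rightarrow> complex mat" where
  "gram_mat N C X = mat N N (\<lambda>(a, b). \<Sum>c\<in>C. X a c * cnj (X b c))"

lemma quadratic_form_gram_mat:
  "(\<Sum>a<N. \<Sum>b<N. cnj (v a) * gram_mat N C X $$ (a, b) * v b)
    = complex_of_real (\<Sum>c\<in>C. (cmod (\<Sum>a<N. cnj (v a) * X a c))\<^sup>2)"
proof -
  have "(\<Sum>a<N. \<Sum>b<N. cnj (v a) * gram_mat N C X $$ (a, b) * v b)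
      = (\<Sum>a<N. \<Sum>b<N. \<Sum>c\<in>C. (cnj (v a) * X a c) * (v b * cnj (X b c)))"
    by (simp add: gram_mat_def sum_distrib_left sum_distrib_right mult_ac)
  also have "\<dots> = (\<Sum>c\<in>C. \<Sum>a<N. \<Sum>b<N. (cnj (v a) * X a c) * (v b * cnj (X b c)))"
    by (rule sum_rotate3)
  also have "\<dots> = (\<Sum>c\<in>C. (\<Sum>a<N. cnj (v a) * X a c) * (\<Sum>b<N. v b * cnj (X b c)))"
    unfolding sum_product ..
  also have "\<dots> = complex_of_real (\<Sum>c\<in>C. (cmod (\<Sum>a<N. cnj (v a) * X a c))\<^sup>2)"
    by (simp add: complex_norm_square del: of_real_power)
  finally show ?thesis .
qed

lemma gram_mat_hermitian:
  "gram_mat N C X \<in> carrier_mat N N" "mat_adjoint (gram_mat N C X) = gram_mat N C X"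
  by (auto simp: gram_mat_def mult.commute intro!: eq_matI)

text \<open>Both sides evaluate the quadratic form at \<open>v\<close>: once from the amplitudes,
  once from the eigenvalues.\<close>

lemma gram_mat_spectral_form:
  assumes U: "U \<in> carrier_mat N N"
    and r: "gram_mat N C X = U * mat_diag N (\<lambda>i. complex_of_real (l i)) * mat_adjoint U"
  shows "(\<Sum>c\<in>C. (cmod (\<Sum>a<N. cnj (v a) * X a c))\<^sup>2)
    = (\<Sum>i<N. (cmod (\<Sum>a<N. cnj (v a) * U $$ (a, i)))\<^sup>2 * l i)" (is "?L = ?R")
proof -
  have "complex_of_real ?L = complex_of_real ?R"
    unfolding quadratic_form_gram_mat[symmetric] quadratic_form_spectral[OF U, symmetric] r ..
  then show ?thesis by (simp only: of_real_eq_iff)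
qed

text \<open>At an eigenvector the spectral form reduces to its own eigenvalue. The eigenvalues
  thereby become outcome probabilities of a measurement in the eigenbasis, and in particular are
  nonnegative.\<close>

lemma gram_mat_eigenvalue:
  assumes U: "unitary_mat N U"
    and r: "gram_mat N C X = U * mat_diag N (\<lambda>i. complex_of_real (l i)) * mat_adjoint U"
    and i: "i < N"
  shows "l i = (\<Sum>c\<in>C. (cmod (\<Sum>a<N. cnj (U $$ (a, i)) * X a c))\<^sup>2)"
proof -
  have "U \<in> carrier_mat N N" using U by (simp add: unitary_mat_def)
  from gram_mat_spectral_form[OF this r, of "\<lambda>a. U $$ (a, i)"]
  have "(\<Sum>c\<in>C. (cmod (\<Sum>a<N. cnj (U $$ (a, i)) * X a c))\<^sup>2)
      = (\<Sum>k<N. (cmod (\<Sum>a<N. cnj (U $$ (a, i)) * U $$ (a, k)))\<^sup>2 * l k)" .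
  also have "\<dots> = (\<Sum>k<N. if k = i then l i else 0)"
    using i by (intro sum.cong) (auto simp: unitary_mat_cols[OF U])
  finally show ?thesis using i by simp
qed

lemma sum_unitary_isometry:
  assumes "unitary_mat N V"
  shows "(\<Sum>j<N. \<Sum>c\<in>C. (cmod (\<Sum>a<N. cnj (V $$ (a, j)) * Z a c))\<^sup>2) = (\<Sum>a<N. \<Sum>c\<in>C. (cmod (Z a c))\<^sup>2)"
proof -
  have "(\<Sum>j<N. \<Sum>c\<in>C. (cmod (\<Sum>a<N. cnj (V $$ (a, j)) * Z a c))\<^sup>2)
      = (\<Sum>c\<in>C. \<Sum>a<N. (cmod (Z a c))\<^sup>2)"
    by (subst sum.swap) (simp add: unitary_mat_isometry[OF assms])
  then show ?thesis by (subst sum.swap)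
qed

text \<open>A measurement in the basis \<open>V\<close> does not lower the entropy: its outcome
  distribution is the image of the spectrum under the doubly stochastic matrix of squared moduli of
  the entries of the unitary \<open>Q\<close>.\<close>

lemma vN_entropy_gram_mat_le:
  assumes V: "unitary_mat N V"
  shows "vN_entropy (gram_mat N C X)
    \<le> (\<Sum>j<N. eta (\<Sum>c\<in>C. (cmod (\<Sum>a<N. cnj (V $$ (a, j)) * X a c))\<^sup>2))"
proof -
  obtain U l where U: "unitary_mat N U"
    and r: "gram_mat N C X = U * mat_diag N (\<lambda>i. complex_of_real (l i)) * mat_adjoint U"
    and S: "vN_entropy (gram_mat N C X) = (\<Sum>i<N. eta (l i))"
    using vN_entropy_spectral[OF gram_mat_hermitian] by blast
  have Uc: "U \<in> carrier_mat N N" and Vc: "V \<in> carrier_mat N N" using U V by (auto simp: unitary_mat_def)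
  define Q where "Q = mat_adjoint V * U"
  have Qu: "unitary_mat N Q" unfolding Q_def by (intro unitary_mat_mult unitary_mat_adjoint U V)
  have Q: "Q $$ (j, i) = (\<Sum>a<N. cnj (V $$ (a, j)) * U $$ (a, i))" if "i < N" "j < N" for i j
    unfolding Q_def using Uc Vc that by (subst index_mult_sum[of _ N N _ N]) auto
  note quad = gram_mat_spectral_form[OF Uc r]
  have l: "0 \<le> l i" if "i < N" for i
    unfolding gram_mat_eigenvalue[OF U r that] by (simp add: sum_nonneg)
  have "(\<Sum>i<N. eta (l i)) \<le> (\<Sum>j<N. eta (\<Sum>i<N. (cmod (Q $$ (j, i)))\<^sup>2 * l i))"
    using l by (intro sum_eta_le_doubly_stochastic)
      (auto simp: unitary_mat_col_norm[OF Qu] unitary_mat_row_norm[OF Qu])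
  also have "\<dots> = (\<Sum>j<N. eta (\<Sum>c\<in>C. (cmod (\<Sum>a<N. cnj (V $$ (a, j)) * X a c))\<^sup>2))"
    unfolding quad by (intro sum.cong refl arg_cong[of _ _ eta]) (auto simp: Q)
  finally show ?thesis unfolding S .
qed

text \<open>Both states are measured in an eigenbasis of the second. This is exact for the entropy
  of the second and an upper bound for the first, so only two outcome distributions have to be
  compared.\<close>

lemma vN_entropy_gram_mat_diff_le:
  assumes C: "finite C"
    and X: "(\<Sum>a<N. \<Sum>c\<in>C. (cmod (X a c))\<^sup>2) = 1"
    and Y: "(\<Sum>a<N. \<Sum>c\<in>C. (cmod (Y a c))\<^sup>2) = 1"
    and XY: "sqrt (\<Sum>a<N. \<Sum>c\<in>C. (cmod (X a c - Y a c))\<^sup>2) *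
      sqrt (\<Sum>a<N. \<Sum>c\<in>C. (cmod (X a c + Y a c))\<^sup>2) \<le> 2 * s"
    and s: "0 < s" "s \<le> 1"
  shows "vN_entropy (gram_mat N C X) \<le> vN_entropy (gram_mat N C Y) + eta s + N * s / ln 2"
proof -
  obtain V m where V: "unitary_mat N V"
    and r: "gram_mat N C Y = V * mat_diag N (\<lambda>i. complex_of_real (m i)) * mat_adjoint V"
    and S: "vN_entropy (gram_mat N C Y) = (\<Sum>i<N. eta (m i))"
    using vN_entropy_spectral[OF gram_mat_hermitian] by blast
  define x where "x j c = (\<Sum>a<N. cnj (V $$ (a, j)) * X a c)" for j c
  define y where "y j c = (\<Sum>a<N. cnj (V $$ (a, j)) * Y a c)" for j c
  note m = gram_mat_eigenvalue[OF V r, folded y_def]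
  have diff: "(\<Sum>a<N. cnj (V $$ (a, j)) * (X a c - Y a c)) = x j c - y j c"
    and add: "(\<Sum>a<N. cnj (V $$ (a, j)) * (X a c + Y a c)) = x j c + y j c" for j c
    by (simp_all add: x_def y_def algebra_simps sum.distrib sum_subtractf)
  have "(\<Sum>j<N. \<bar>(\<Sum>c\<in>C. (cmod (x j c))\<^sup>2) - m j\<bar>)
      \<le> (\<Sum>j<N. \<Sum>c\<in>C. \<bar>(cmod (x j c))\<^sup>2 - (cmod (y j c))\<^sup>2\<bar>)"
    by (intro sum_mono) (auto simp: m sum_subtractf[symmetric] intro: sum_abs)
  also have "\<dots> \<le> sqrt (\<Sum>j<N. \<Sum>c\<in>C. (cmod (x j c - y j c))\<^sup>2) *
      sqrt (\<Sum>j<N. \<Sum>c\<in>C. (cmod (x j c + y j c))\<^sup>2)"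
    using sum_abs_diff_norm_sq_le[of "\<lambda>(j, c). x j c" "\<lambda>(j, c). y j c" "{..<N} \<times> C"]
    by (simp add: sum.cartesian_product split_def)
  \<comment> \<open>The change of basis preserves the norms of the difference and the sum of
    \<open>X\<close> and \<open>Y\<close>.\<close>
  also have "\<dots> \<le> 2 * s"
    using XY sum_unitary_isometry[OF V, of "\<lambda>a c. X a c - Y a c" C]
      sum_unitary_isometry[OF V, of "\<lambda>a c. X a c + Y a c" C] by (simp only: diff add)
  finally have tv: "(\<Sum>j<N. \<bar>(\<Sum>c\<in>C. (cmod (x j c))\<^sup>2) - m j\<bar>) \<le> 2 * s" .
  have "vN_entropy (gram_mat N C X) \<le> (\<Sum>j<N. eta (\<Sum>c\<in>C. (cmod (x j c))\<^sup>2))"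
    unfolding x_def by (rule vN_entropy_gram_mat_le[OF V])
  also have "\<dots> \<le> (\<Sum>j<N. eta (m j)) + eta s + N * s / ln 2"
    by (rule sum_eta_diff_le[OF _ _ _ _ tv s])
       (use sum_unitary_isometry[OF V, of X C] sum_unitary_isometry[OF V, of Y C] X Y m
        in \<open>auto simp: x_def y_def sum_nonneg\<close>)
  finally show ?thesis by (simp add: S)
qed

section \<open>Reduced states\<close>

text \<open>The last site is the least significant digit, so the induction removes it: it is the
  remainder modulo \<open>d\<close>, and the other sites are the digits of the quotient.\<close>

lemma site_digits_eqD:
  assumes "x < d ^ n" "y < d ^ n" "\<forall>k\<in>{1..n}. site_digit d n k x = site_digit d n k y"
  shows "x = y"
  using assms
proof (induction n arbitrary: x y)
  case (Suc n)
  have d: "0 < d" using Suc.prems(1) by (cases d) auto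
  have "x mod d = y mod d"
    using bspec[OF Suc.prems(3), of "Suc n"] by (simp add: site_digit_def)
  moreover have "x div d = y div d"
  proof (rule Suc.IH)
    show "x div d < d ^ n" "y div d < d ^ n"
      using Suc.prems(1,2) d by (auto simp: div_less_iff_less_mult mult.commute)
    show "\<forall>k\<in>{1..n}. site_digit d n k (x div d) = site_digit d n k (y div d)"
    proof
      fix k assume k: "k \<in> {1..n}"
      then have "d ^ (Suc n - k) = d * d ^ (n - k)" by (simp add: Suc_diff_le)
      then show "site_digit d n k (x div d) = site_digit d n k (y div d)"
        using bspec[OF Suc.prems(3), of k] k by (simp add: site_digit_def div_mult2_eq)
    qed
  qed
  ultimately show ?case by (metis div_mult_mod_eq)
qed simp

text \<open>The least site carries the leading digit, and removing it leaves the weights of the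
  others unchanged. This drives the inductions on \<open>card A\<close>.\<close>

lemma sub_index_Min:
  assumes A: "finite A" "A \<noteq> {}"
  defines "k \<equiv> Min A"
  shows "sub_index d n A x = site_digit d n k x * d ^ card (A - {k}) + sub_index d n (A - {k}) x"
proof -
  have k: "k \<in> A" "\<And>l. l \<in> A \<Longrightarrow> k \<le> l" using A by (auto simp: k_def)
  have "{l \<in> A. k < l} = A - {k}" using k by force
  moreover have "(\<Sum>j\<in>A - {k}. site_digit d n j x * d ^ card {l \<in> A. j < l})
      = (\<Sum>j\<in>A - {k}. site_digit d n j x * d ^ card {l \<in> A - {k}. j < l})"
  proof (rule sum.cong)
    fix j assume "j \<in> A - {k}"
    then have "{l \<in> A. j < l} = {l \<in> A - {k}. j < l}" using k by force
    then show "site_digit d n j x * d ^ card {l \<in> A. j < l} = site_digit d n j x * d ^ card {l \<in> A - {k}. j < l}"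
      by (rule arg_cong)
  qed simp
  ultimately show ?thesis
    unfolding sub_index_def sum.remove[OF A(1) k(1)] by (simp only:)
qed

lemma sub_index_less:
  assumes "finite A" "0 < d"
  shows "sub_index d n A x < d ^ card A"
  using assms(1)
proof (induction "card A" arbitrary: A)
  case 0
  then show ?case by (simp add: sub_index_def)
next
  case (Suc c)
  then have "A \<noteq> {}" by auto
  then have A: "A \<noteq> {}" "Min A \<in> A" using Suc.prems(1) by (auto intro: Min_in)
  have c: "c = card (A - {Min A})" using Suc A by simp
  have "site_digit d n (Min A) x \<le> d - 1"
    using assms by (simp add: site_digit_def Suc_leI[THEN diff_le_mono[of _ _ 1]] less_Suc_eq_le[symmetric])
  then have "site_digit d n (Min A) x * d ^ c + sub_index d n (A - {Min A}) x < (d - 1) * d ^ c + d ^ c"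
    using Suc.hyps(1)[OF c] Suc.prems c by (intro add_le_less_mono mult_right_mono) auto
  also have "\<dots> = d ^ card A" using assms Suc.hyps(2) by (cases d) (auto simp flip: Suc.hyps(2))
  finally show ?case using sub_index_Min[OF Suc.prems A(1), of d n x] c by simp
qed

text \<open>Uniqueness of base \<open>d\<close> digits: the part below the leading digit is smaller
  than its weight by \<open>sub_index_less\<close>, so division with remainder recovers
  both.\<close>

lemma sub_index_eqD:
  assumes "finite A" "0 < d" "sub_index d n A x = sub_index d n A y" "k \<in> A"
  shows "site_digit d n k x = site_digit d n k y"
  using assms(1,3,4)
proof (induction "card A" arbitrary: A)
  case (Suc c)
  then have "A \<noteq> {}" by auto
  then have A: "A \<noteq> {}" "Min A \<in> A" using Suc.prems(1) by (auto intro: Min_in)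
  let ?k = "Min A" let ?B = "A - {?k}"
  have c: "c = card ?B" using Suc A by simp
  have "site_digit d n ?k x * d ^ card ?B + sub_index d n ?B x
      = site_digit d n ?k y * d ^ card ?B + sub_index d n ?B y"
    using Suc.prems(2) sub_index_Min[OF Suc.prems(1) A(1), of d n] by simp
  moreover have "sub_index d n ?B z < d ^ card ?B" for z
    using Suc.prems assms(2) by (intro sub_index_less) auto
  moreover have "a = a' \<and> r = r'" if "a * m + r = a' * m + r'" "r < m" "r' < m" for a a' r r' m :: nat
  proof -
    have "(a * m + r) div m = a" "(a' * m + r') div m = a'" using that(2,3) by auto
    then have "a = a'" using that(1) by metis
    then show ?thesis using that(1) by simp
  qed
  ultimately have "site_digit d n ?k x = site_digit d n ?k y" "sub_index d n ?B x = sub_index d n ?B y"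
    by blast+
  then show ?case using Suc.hyps(1)[OF c] Suc.prems by (cases "k = ?k") auto
qed simp

text \<open>The environment configuration is kept as a function instead of a number;
  \<open>restrict\<close> fixes its values elsewhere, so that equality of functions means equality
  of the digits outside \<open>A\<close>.\<close>

definition env_index :: "nat \<Rightarrow> nat \<Rightarrow> nat set \<Rightarrow> nat \<Rightarrow> nat \<Rightarrow> nat" where
  "env_index d n A x = restrict (\<lambda>k. site_digit d n k x) ({1..n} - A)"

lemma env_index_eq_iff:
  "env_index d n A x = env_index d n A y \<longleftrightarrow> (\<forall>k\<in>{1..n} - A. site_digit d n k x = site_digit d n k y)"
proof
  assume eq: "env_index d n A x = env_index d n A y"
  show "\<forall>k\<in>{1..n} - A. site_digit d n k x = site_digit d n k y"
  proof
    fix k assume "k \<in> {1..n} - A"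
    then show "site_digit d n k x = site_digit d n k y"
      using fun_cong[OF eq, of k] by (simp add: env_index_def)
  qed
next
  assume "\<forall>k\<in>{1..n} - A. site_digit d n k x = site_digit d n k y"
  then show "env_index d n A x = env_index d n A y"
    unfolding env_index_def by (intro restrict_ext) auto
qed

lemma inj_on_indices:
  assumes "A \<subseteq> {1..n}" "0 < d"
  shows "inj_on (\<lambda>x. (sub_index d n A x, env_index d n A x)) {..<d ^ n}"
proof (rule inj_onI)
  fix x y
  assume xy: "x \<in> {..<d ^ n}" "y \<in> {..<d ^ n}"
    and eq: "(sub_index d n A x, env_index d n A x) = (sub_index d n A y, env_index d n A y)"
  have "finite A" using assms by (auto intro: finite_subset)
  then have "\<forall>k\<in>A. site_digit d n k x = site_digit d n k y"
    using eq by (intro ballI sub_index_eqD[OF _ assms(2)]) auto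
  moreover have "\<forall>k\<in>{1..n} - A. site_digit d n k x = site_digit d n k y"
    using eq unfolding env_index_eq_iff[symmetric] by simp
  ultimately have "\<forall>k\<in>{1..n}. site_digit d n k x = site_digit d n k y" by blast
  then show "x = y" using xy by (intro site_digits_eqD) auto
qed

section \<open>Pure states as tables of system and environment amplitudes\<close>

text \<open>The sum has at most one term when \<open>A \<subseteq> {1..n}\<close>, by \<open>inj_on_indices\<close>; writing it as a sum
  makes it linear in \<open>p\<close> without a case distinction.\<close>

definition amplitude :: "nat \<Rightarrow> nat \<Rightarrow> nat set \<Rightarrow> (nat \<Rightarrow> complex) \<Rightarrow> nat \<Rightarrow> (nat \<Rightarrow> nat) \<Rightarrow> complex" where
  "amplitude d n A p a c = (\<Sum>x | x < d ^ n \<and> sub_index d n A x = a \<and> env_index d n A x = c. p x)"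

text \<open>By \<open>inj_on_indices\<close> the table is a relabelling of \<open>p\<close>: each
  \<open>x\<close> has a cell to itself, and cells reached by no \<open>x\<close> hold 0.\<close>

lemma sum_amplitude:
  assumes A: "A \<subseteq> {1..n}" and d: "0 < d"
  shows "(\<Sum>a<d ^ card A. \<Sum>c\<in>env_index d n A ` {..<d ^ n}. (cmod (amplitude d n A p a c))\<^sup>2)
    = (\<Sum>x<d ^ n. (cmod (p x))\<^sup>2)"
proof -
  let ?k = "\<lambda>x. (sub_index d n A x, env_index d n A x)"
  let ?F = "\<lambda>(a, c). (cmod (amplitude d n A p a c))\<^sup>2"
  have fin: "finite A" using A by (auto intro: finite_subset)
  have "(\<Sum>a<d ^ card A. \<Sum>c\<in>env_index d n A ` {..<d ^ n}. (cmod (amplitude d n A p a c))\<^sup>2)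
      = sum ?F ({..<d ^ card A} \<times> env_index d n A ` {..<d ^ n})"
    by (simp add: sum.cartesian_product)
  also have "\<dots> = sum ?F (?k ` {..<d ^ n})"
  proof (rule sum.mono_neutral_right)
    show "?k ` {..<d ^ n} \<subseteq> {..<d ^ card A} \<times> env_index d n A ` {..<d ^ n}"
      using sub_index_less[OF fin d] by auto
    show "\<forall>i\<in>{..<d ^ card A} \<times> env_index d n A ` {..<d ^ n} - ?k ` {..<d ^ n}. ?F i = 0"
    proof
      fix i assume i: "i \<in> {..<d ^ card A} \<times> env_index d n A ` {..<d ^ n} - ?k ` {..<d ^ n}"
      then have E: "{x. x < d ^ n \<and> sub_index d n A x = fst i \<and> env_index d n A x = snd i} = {}"
        by force
      show "?F i = 0" unfolding amplitude_def split_def E by simp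
    qed
  qed auto
  also have "\<dots> = (\<Sum>x<d ^ n. ?F (?k x))"
    using sum.reindex[OF inj_on_indices[OF A d], of ?F] by simp
  also have "\<dots> = (\<Sum>x<d ^ n. (cmod (p x))\<^sup>2)"
  proof (rule sum.cong)
    fix x assume x: "x \<in> {..<d ^ n}"
    then have "{y. y < d ^ n \<and> sub_index d n A y = sub_index d n A x \<and> env_index d n A y = env_index d n A x} = {x}"
      using inj_onD[OF inj_on_indices[OF A d]] by fastforce
    then show "?F (?k x) = (cmod (p x))\<^sup>2" by (simp add: amplitude_def)
  qed simp
  finally show ?thesis .
qed

lemma amplitude_diff: "amplitude d n A p a c - amplitude d n A q a c = amplitude d n A (\<lambda>x. p x - q x) a c"
  and amplitude_add: "amplitude d n A p a c + amplitude d n A q a c = amplitude d n A (\<lambda>x. p x + q x) a c"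
  by (simp_all add: amplitude_def sum.distrib sum_subtractf)

text \<open>Multiplying out the amplitudes gives pairs of basis indices with a common environment
  configuration. Sorted by that configuration, these are the pairs over which the partial trace
  sums.\<close>

lemma reduced_op_ket_bra:
  assumes "\<psi> \<in> carrier_vec (d ^ n)"
  shows "reduced_op d n A (ket_bra \<psi>)
    = gram_mat (d ^ card A) (env_index d n A ` {..<d ^ n}) (amplitude d n A (\<lambda>x. \<psi> $ x))"
proof -
  let ?E = "env_index d n A ` {..<d ^ n}"
  let ?S = "\<lambda>a c. {x. x < d ^ n \<and> sub_index d n A x = a \<and> env_index d n A x = c}"
  let ?R = "\<lambda>a b. {(x, y). x < d ^ n \<and> y < d ^ n \<and>
                       sub_index d n A x = a \<and> sub_index d n A y = b \<and>
                       (\<forall>k\<in>{1..n} - A. site_digit d n k x = site_digit d n k y)}"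
  have "(\<Sum>c\<in>?E. amplitude d n A (\<lambda>x. \<psi> $ x) a c * cnj (amplitude d n A (\<lambda>x. \<psi> $ x) b c))
      = (\<Sum>(x, y)\<in>?R a b. ket_bra \<psi> $$ (x, y))" for a b
  proof -
    have "(\<Sum>c\<in>?E. amplitude d n A (\<lambda>x. \<psi> $ x) a c * cnj (amplitude d n A (\<lambda>x. \<psi> $ x) b c))
        = (\<Sum>c\<in>?E. \<Sum>(x, y)\<in>?S a c \<times> ?S b c. \<psi> $ x * cnj (\<psi> $ y))"
      by (simp add: amplitude_def sum_product sum.cartesian_product)
    also have "\<dots> = (\<Sum>(x, y)\<in>(\<Union>c\<in>?E. ?S a c \<times> ?S b c). \<psi> $ x * cnj (\<psi> $ y))"
      by (rule sum.UNION_disjoint[symmetric]) auto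
    also have "(\<Union>c\<in>?E. ?S a c \<times> ?S b c) = ?R a b"
      unfolding env_index_eq_iff[symmetric] by auto
    also have "(\<Sum>(x, y)\<in>?R a b. \<psi> $ x * cnj (\<psi> $ y)) = (\<Sum>(x, y)\<in>?R a b. ket_bra \<psi> $$ (x, y))"
      using assms by (intro sum.cong) (auto simp: ket_bra_def)
    finally show ?thesis .
  qed
  then show ?thesis unfolding reduced_op_def gram_mat_def by (simp only:)
qed

section \<open>Continuity of the entropy of reduced pure states\<close>

text \<open>The norms of \<open>\<psi> - \<phi>\<close> and \<open>\<psi> + \<phi>\<close> multiply to \<open>2 sqrt (1 - <\<psi>|\<phi>>\<^sup>2)\<close> when the overlap is real.\<close>

lemma vN_entropy_reduced_diff_le_real_overlap:
  assumes A: "A \<subseteq> {1..n}" and d: "0 < d"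
    and psi: "\<psi> \<in> carrier_vec (d ^ n)" "(\<Sum>x<d ^ n. (cmod (\<psi> $ x))\<^sup>2) = 1"
    and phi: "\<phi> \<in> carrier_vec (d ^ n)" "(\<Sum>x<d ^ n. (cmod (\<phi> $ x))\<^sup>2) = 1"
    and c: "(\<Sum>x<d ^ n. \<psi> $ x * cnj (\<phi> $ x)) = complex_of_real c" "1 - s\<^sup>2 \<le> c\<^sup>2"
    and s: "0 < s" "s \<le> 1"
  shows "vN_entropy (reduced_op d n A (ket_bra \<psi>))
    \<le> vN_entropy (reduced_op d n A (ket_bra \<phi>)) + eta s + real (d ^ n) * s / ln 2"
proof -
  have "Re (\<Sum>x<d ^ n. \<psi> $ x * cnj (\<phi> $ x)) = c" using c by simp
  then have R: "(\<Sum>x<d ^ n. Re (\<psi> $ x) * Re (\<phi> $ x) + Im (\<psi> $ x) * Im (\<phi> $ x)) = c"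
    by (simp add: Re_sum)
  have "(\<Sum>x<d ^ n. (cmod (\<psi> $ x - \<phi> $ x))\<^sup>2)
      = (\<Sum>x<d ^ n. (cmod (\<psi> $ x))\<^sup>2 + (cmod (\<phi> $ x))\<^sup>2
          - 2 * (Re (\<psi> $ x) * Re (\<phi> $ x) + Im (\<psi> $ x) * Im (\<phi> $ x)))"
    unfolding cmod_power2 by (intro sum.cong) (auto simp: power2_eq_square algebra_simps)
  also have "\<dots> = 2 - 2 * c"
    unfolding sum_subtractf sum.distrib sum_distrib_left[symmetric] psi phi
    using R by (simp add: sum.distrib)
  finally have minus: "(\<Sum>x<d ^ n. (cmod (\<psi> $ x - \<phi> $ x))\<^sup>2) = 2 - 2 * c" .
  have "(\<Sum>x<d ^ n. (cmod (\<psi> $ x + \<phi> $ x))\<^sup>2)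
      = (\<Sum>x<d ^ n. (cmod (\<psi> $ x))\<^sup>2 + (cmod (\<phi> $ x))\<^sup>2
          + 2 * (Re (\<psi> $ x) * Re (\<phi> $ x) + Im (\<psi> $ x) * Im (\<phi> $ x)))"
    unfolding cmod_power2 by (intro sum.cong) (auto simp: power2_eq_square algebra_simps)
  also have "\<dots> = 2 + 2 * c"
    unfolding sum.distrib sum_distrib_left[symmetric] psi phi
    using R by (simp add: sum.distrib)
  finally have plus: "(\<Sum>x<d ^ n. (cmod (\<psi> $ x + \<phi> $ x))\<^sup>2) = 2 + 2 * c" .
  have "sqrt (2 - 2 * c) * sqrt (2 + 2 * c) = sqrt (4 * (1 - c\<^sup>2))"
    unfolding real_sqrt_mult[symmetric] by (simp add: algebra_simps power2_eq_square)
  also have "\<dots> \<le> sqrt ((2 * s)\<^sup>2)"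
    using c by (subst real_sqrt_le_iff) (simp add: power_mult_distrib)
  also have "\<dots> = 2 * s" using s by (subst real_sqrt_abs) simp
  finally have le: "sqrt (2 - 2 * c) * sqrt (2 + 2 * c) \<le> 2 * s" .
  have "vN_entropy (reduced_op d n A (ket_bra \<psi>))
    \<le> vN_entropy (reduced_op d n A (ket_bra \<phi>)) + eta s + real (d ^ card A) * s / ln 2"
    unfolding reduced_op_ket_bra[OF psi(1)] reduced_op_ket_bra[OF phi(1)]
    by (rule vN_entropy_gram_mat_diff_le)
      (use s le in \<open>simp_all add: sum_amplitude[OF A d] amplitude_diff amplitude_add psi phi minus plus\<close>)
  \<comment> \<open>The dimension of the subsystem is enlarged to the full one, giving a bound
    uniform in \<open>A\<close>.\<close>
  moreover have "real (d ^ card A) * s / ln 2 \<le> real (d ^ n) * s / ln 2"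
  proof (intro divide_right_mono mult_right_mono)
    have "card A \<le> n" using card_mono[OF _ A] by simp
    then have "d ^ card A \<le> d ^ n" using d by (intro power_increasing) auto
    then show "real (d ^ card A) \<le> real (d ^ n)" by (simp only: of_nat_le_iff)
  qed (use s in auto)
  ultimately show ?thesis by simp
qed

lemma unit_vec_norm:
  assumes "\<psi> \<in> carrier_vec N" "\<psi> \<bullet>c \<psi> = 1"
  shows "(\<Sum>x<N. (cmod (\<psi> $ x))\<^sup>2) = 1"
proof -
  have "complex_of_real (\<Sum>x<N. (cmod (\<psi> $ x))\<^sup>2) = \<psi> \<bullet>c \<psi>"
    using assms(1) by (auto simp: scalar_prod_def complex_norm_square lessThan_atLeast0
        simp del: of_real_power intro!: sum.cong)
  then show ?thesis using assms(2) of_real_eq_1_iff by metis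
qed

lemma cscalar_prod_sum:
  assumes "\<psi> \<in> carrier_vec N" "\<phi> \<in> carrier_vec N"
  shows "\<psi> \<bullet>c \<phi> = (\<Sum>x<N. \<psi> $ x * cnj (\<phi> $ x))"
  using assms by (auto simp: scalar_prod_def lessThan_atLeast0 intro!: sum.cong)

lemma ket_bra_smult:
  assumes "cmod \<omega> = 1"
  shows "ket_bra (\<omega> \<cdot>\<^sub>v \<psi>) = ket_bra \<psi>"
proof -
  have "\<omega> * cnj \<omega> = 1" using assms by (simp add: complex_norm_square[symmetric])
  then have "\<omega> * x * (cnj \<omega> * y) = x * y" for x y
    by (metis mult.assoc mult.left_commute mult_1)
  then show ?thesis unfolding ket_bra_def by (intro eq_matI) auto
qed

text \<open>A global phase does not change the state, so one is chosen that makes the overlap real.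
  The one-sided estimate, applied in both directions, then bounds the absolute value.\<close>

lemma vN_entropy_reduced_diff_le:
  assumes A: "A \<subseteq> {1..n}" and d: "0 < d"
    and psi: "\<psi> \<in> carrier_vec (d ^ n)" "\<psi> \<bullet>c \<psi> = 1"
    and phi: "\<phi> \<in> carrier_vec (d ^ n)" "\<phi> \<bullet>c \<phi> = 1"
    and c: "1 - s\<^sup>2 \<le> (cmod (\<psi> \<bullet>c \<phi>))\<^sup>2"
    and s: "0 < s" "s \<le> 1"
  shows "\<bar>vN_entropy (reduced_op d n A (ket_bra \<psi>)) - vN_entropy (reduced_op d n A (ket_bra \<phi>))\<bar>
    \<le> eta s + real (d ^ n) * s / ln 2"
proof -
  define z where "z = \<psi> \<bullet>c \<phi>"
  \<comment> \<open>For vanishing overlap any phase would do; 1 keeps the modulus equal to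
    1.\<close>
  define \<omega> where "\<omega> = (if z = 0 then 1 else cnj z / cmod z)"
  have w: "cmod \<omega> = 1" by (simp add: \<omega>_def norm_divide)
  have wz: "\<omega> * z = complex_of_real (cmod z)"
    by (simp add: \<omega>_def complex_norm_square[symmetric] mult.commute power2_eq_square)
  define \<chi> where "\<chi> = \<omega> \<cdot>\<^sub>v \<psi>"
  have chi: "\<chi> \<in> carrier_vec (d ^ n)" using psi by (simp add: \<chi>_def)
  have x: "\<chi> $ x = \<omega> * \<psi> $ x" if "x < d ^ n" for x using psi that by (simp add: \<chi>_def)
  have n1: "(\<Sum>x<d ^ n. (cmod (\<chi> $ x))\<^sup>2) = 1"
    using unit_vec_norm[OF psi] by (simp add: x norm_mult w)
  have "(\<Sum>x<d ^ n. \<chi> $ x * cnj (\<phi> $ x)) = \<omega> * z"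
    unfolding z_def cscalar_prod_sum[OF psi(1) phi(1)] sum_distrib_left
    by (intro sum.cong) (auto simp: x)
  then have o1: "(\<Sum>x<d ^ n. \<chi> $ x * cnj (\<phi> $ x)) = complex_of_real (cmod z)" using wz by simp
  have "(\<Sum>x<d ^ n. \<phi> $ x * cnj (\<chi> $ x)) = cnj (\<Sum>x<d ^ n. \<chi> $ x * cnj (\<phi> $ x))"
    by (simp add: mult.commute)
  then have o2: "(\<Sum>x<d ^ n. \<phi> $ x * cnj (\<chi> $ x)) = complex_of_real (cmod z)" using o1 by simp
  have "ket_bra \<psi> = ket_bra \<chi>" using ket_bra_smult[OF w] by (simp add: \<chi>_def)
  then show ?thesis
    using vN_entropy_reduced_diff_le_real_overlap[OF A d chi n1 phi(1) unit_vec_norm[OF phi] o1 _ s]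
      vN_entropy_reduced_diff_le_real_overlap[OF A d phi(1) unit_vec_norm[OF phi] chi n1 o2 _ s] c
    by (simp add: z_def abs_le_iff)
qed

section \<open>Polytopes of pure states\<close>

definition expect :: "nat \<Rightarrow> complex vec \<Rightarrow> complex mat \<Rightarrow> complex" where
  "expect N \<psi> M = (\<Sum>i<N. \<Sum>j<N. cnj (\<psi> $ i) * M $$ (i, j) * \<psi> $ j)"

lemma expect_ket_bra:
  assumes "\<psi> \<in> carrier_vec N" "\<phi> \<in> carrier_vec N"
  shows "expect N \<psi> (ket_bra \<phi>) = complex_of_real ((cmod (\<psi> \<bullet>c \<phi>))\<^sup>2)"
proof -
  have "expect N \<psi> (ket_bra \<phi>) = cnj (\<Sum>i<N. \<psi> $ i * cnj (\<phi> $ i)) * (\<Sum>j<N. \<psi> $ j * cnj (\<phi> $ j))"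
    using assms(2) by (simp add: expect_def ket_bra_def sum_product mult_ac)
  then show ?thesis
    unfolding cscalar_prod_sum[OF assms, symmetric] by (simp only: complex_norm_square mult.commute)
qed

lemma expect_lincomb:
  assumes "X \<in> carrier_mat N N" "Y \<in> carrier_mat N N"
  shows "expect N \<psi> (a \<cdot>\<^sub>m X + b \<cdot>\<^sub>m Y) = a * expect N \<psi> X + b * expect N \<psi> Y"
  unfolding expect_def sum_distrib_left sum.distrib[symmetric]
  by (intro sum.cong refl) (use assms in \<open>auto simp: distrib_left distrib_right mult_ac\<close>)

lemma cmod_overlap_le_1:
  assumes psi: "\<psi> \<in> carrier_vec N" "\<psi> \<bullet>c \<psi> = 1" and phi: "\<phi> \<in> carrier_vec N" "\<phi> \<bullet>c \<phi> = 1"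
  shows "(cmod (\<psi> \<bullet>c \<phi>))\<^sup>2 \<le> 1"
proof -
  have "cmod (\<psi> \<bullet>c \<phi>) \<le> (\<Sum>x<N. \<bar>cmod (\<psi> $ x)\<bar> * \<bar>cmod (\<phi> $ x)\<bar>)"
    unfolding cscalar_prod_sum[OF psi(1) phi(1)]
    by (rule order_trans[OF norm_sum]) (simp add: norm_mult)
  also have "\<dots> \<le> L2_set (\<lambda>x. cmod (\<psi> $ x)) {..<N} * L2_set (\<lambda>x. cmod (\<phi> $ x)) {..<N}"
    by (rule L2_set_mult_ineq)
  also have "\<dots> = 1" by (simp add: L2_set_def unit_vec_norm[OF psi] unit_vec_norm[OF phi])
  finally show ?thesis by (simp add: power_le_one)
qed

text \<open>The equality case of Cauchy-Schwarz: the squared norm of \<open>\<psi>\<close> minus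
  \<open>c\<close> times \<open>\<phi>\<close> expands to 0, so the vectors differ by the phase
  \<open>c\<close>.\<close>

lemma ket_bra_eq_if_overlap_1:
  assumes psi: "\<psi> \<in> carrier_vec N" "\<psi> \<bullet>c \<psi> = 1" and phi: "\<phi> \<in> carrier_vec N" "\<phi> \<bullet>c \<phi> = 1"
    and 1: "(cmod (\<psi> \<bullet>c \<phi>))\<^sup>2 = 1"
  shows "ket_bra \<psi> = ket_bra \<phi>"
proof -
  define c where "c = \<psi> \<bullet>c \<phi>"
  have c: "cmod c = 1" using 1 norm_ge_zero[of c] unfolding c_def power2_eq_1_iff by linarith
  have sc: "(\<Sum>x<N. \<psi> $ x * cnj (\<phi> $ x)) = c" by (simp add: c_def cscalar_prod_sum[OF psi(1) phi(1)])
  have "complex_of_real (\<Sum>x<N. (cmod (\<psi> $ x - c * \<phi> $ x))\<^sup>2)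
      = (\<Sum>x<N. complex_of_real ((cmod (\<psi> $ x))\<^sup>2) + complex_of_real ((cmod c)\<^sup>2 * (cmod (\<phi> $ x))\<^sup>2)
          - cnj c * (\<psi> $ x * cnj (\<phi> $ x)) - c * cnj (\<psi> $ x * cnj (\<phi> $ x)))"
    unfolding of_real_sum
    by (intro sum.cong refl) (simp add: complex_norm_square algebra_simps del: of_real_power)
  also have "\<dots> = complex_of_real (\<Sum>x<N. (cmod (\<psi> $ x))\<^sup>2) + complex_of_real ((cmod c)\<^sup>2 * (\<Sum>x<N. (cmod (\<phi> $ x))\<^sup>2))
      - cnj c * c - c * cnj c"
    unfolding sum_subtractf sum.distrib sum_distrib_left[symmetric] cnj_sum[symmetric] of_real_sum[symmetric] sc ..
  also have "\<dots> = complex_of_real (2 - 2 * (cmod c)\<^sup>2)"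
    unfolding unit_vec_norm[OF psi] unit_vec_norm[OF phi]
    by (simp add: complex_norm_square mult.commute c del: of_real_power) (use c in \<open>simp add: complex_norm_square[symmetric]\<close>)
  finally have "(\<Sum>x<N. (cmod (\<psi> $ x - c * \<phi> $ x))\<^sup>2) = 0" using c by (simp only: of_real_eq_iff) simp
  then have "\<forall>x\<in>{..<N}. (cmod (\<psi> $ x - c * \<phi> $ x))\<^sup>2 = 0" by (subst (asm) sum_nonneg_eq_0_iff) auto
  then have "\<psi> = c \<cdot>\<^sub>v \<phi>" using psi phi by (intro eq_vecI) auto
  then show ?thesis using ket_bra_smult[OF c] by simp
qed

lemma mat_trace_ket_bra_mult:
  assumes "\<psi> \<in> carrier_vec N" "B \<in> carrier_mat N N"
  shows "mat_trace (ket_bra \<psi> * B) = expect N \<psi> B"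
proof -
  have k: "ket_bra \<psi> \<in> carrier_mat N N" using assms by (simp add: ket_bra_def)
  have "mat_trace (ket_bra \<psi> * B) = (\<Sum>i<N. \<Sum>j<N. ket_bra \<psi> $$ (i, j) * B $$ (j, i))"
    using k by (simp add: mat_trace_def index_mult_sum[OF k assms(2)] del: index_mult_mat(1))
  also have "\<dots> = (\<Sum>i<N. \<Sum>j<N. \<psi> $ i * cnj (\<psi> $ j) * B $$ (j, i))"
    using assms(1) by (intro sum.cong refl) (auto simp: ket_bra_def)
  finally show ?thesis unfolding expect_def by (subst (asm) sum.swap) (simp add: mult_ac)
qed

text \<open>The reflection \<open>W = 2 |\<psi>><\<psi>| - 1\<close> is unitary, and \<open>Re tr (W B)\<close> bounds the trace norm from below.\<close>

lemma trace_dist_ge: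
  assumes psi: "\<psi> \<in> carrier_vec N" "\<psi> \<bullet>c \<psi> = 1"
    and s: "\<sigma> \<in> carrier_mat N N" "mat_trace \<sigma> = 1"
  shows "1 - Re (expect N \<psi> \<sigma>) \<le> trace_dist (ket_bra \<psi>) \<sigma>"
proof -
  let ?K = "ket_bra \<psi>"
  have K: "?K \<in> carrier_mat N N" using psi by (simp add: ket_bra_def)
  have nn: "(\<Sum>l<N. \<psi> $ l * cnj (\<psi> $ l)) = 1"
    using psi cscalar_prod_sum[OF psi(1) psi(1)] by simp
  have KK: "?K * ?K = ?K"
  proof (rule eq_matI)
    fix i j assume "i < dim_row ?K" "j < dim_col ?K"
    then have ij: "i < N" "j < N" using K by auto
    have "(?K * ?K) $$ (i, j) = (\<Sum>l<N. \<psi> $ i * cnj (\<psi> $ j) * (\<psi> $ l * cnj (\<psi> $ l)))"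
      unfolding index_mult_sum[OF K K ij] using psi ij by (intro sum.cong) (auto simp: ket_bra_def)
    also have "\<dots> = ?K $$ (i, j)"
      unfolding sum_distrib_left[symmetric] nn using psi ij by (simp add: ket_bra_def)
    finally show "(?K * ?K) $$ (i, j) = ?K $$ (i, j)" .
  qed (use K in auto)
  have tr: "mat_trace ?K = 1"
    using nn psi by (simp add: mat_trace_def ket_bra_def)
  define B where "B = ?K - \<sigma>"
  have B: "B \<in> carrier_mat N N" using s by (auto simp: B_def)
  define W where "W = 2 \<cdot>\<^sub>m ?K - 1\<^sub>m N"
  have W: "W \<in> carrier_mat N N" by (auto simp: W_def)
  have "mat_adjoint W = W"
    by (rule eq_matI) (use W psi in \<open>auto simp: W_def ket_bra_def mult.commute\<close>)
  moreover have "W * W = 1\<^sub>m N"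
  proof -
    have "W * W = 2 \<cdot>\<^sub>m ?K * W - 1\<^sub>m N * W"
      unfolding W_def using K by (intro minus_mult_distrib_mat) auto
    also have "2 \<cdot>\<^sub>m ?K * W = 2 \<cdot>\<^sub>m (?K * W)" using K W by (intro mult_smult_assoc_mat) auto
    also have "?K * W = ?K * (2 \<cdot>\<^sub>m ?K) - ?K * 1\<^sub>m N"
      unfolding W_def using K by (intro mult_minus_distrib_mat) auto
    also have "?K * (2 \<cdot>\<^sub>m ?K) = 2 \<cdot>\<^sub>m ?K" using K mult_smult_distrib[OF K K] by (simp add: KK)
    also have "2 \<cdot>\<^sub>m (2 \<cdot>\<^sub>m ?K - ?K * 1\<^sub>m N) - 1\<^sub>m N * W = 1\<^sub>m N"
      by (rule eq_matI) (use W K in \<open>auto simp: W_def algebra_simps\<close>)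
    finally show ?thesis .
  qed
  ultimately have Wu: "unitary_mat N W" using W by (simp add: unitary_mat_def)
  have "W * B = 2 \<cdot>\<^sub>m (?K * B) - B"
    unfolding W_def using K B by (subst minus_mult_distrib_mat[of _ N N _ _ N]) (auto simp: mult_smult_assoc_mat)
  \<comment> \<open>The trace of \<open>B\<close> vanishes because both states have trace 1. What
    remains is twice the expectation of \<open>B\<close>, and this 2 cancels the factor 1/2 of the
    trace distance.\<close>
  then have "mat_trace (W * B) = 2 * mat_trace (?K * B) - mat_trace B"
    using K B by (simp add: mat_trace_def sum_subtractf sum_distrib_left del: index_mult_mat(1))
  also have "mat_trace B = 0"
    using K s tr by (simp add: mat_trace_def B_def sum_subtractf)
  also have "mat_trace (?K * B) = expect N \<psi> ?K - expect N \<psi> \<sigma>"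
    unfolding mat_trace_ket_bra_mult[OF psi(1) B] using K s
    by (simp add: expect_def B_def algebra_simps sum_subtractf)
  also have "expect N \<psi> ?K = 1" using expect_ket_bra[OF psi(1) psi(1)] psi by simp
  finally show ?thesis
    using Re_trace_unitary_le_trace_norm[OF Wu B] by (simp add: trace_dist_def B_def)
qed

lemma mat_trace_ket_bra:
  assumes "\<psi> \<in> carrier_vec N" "\<psi> \<bullet>c \<psi> = 1"
  shows "mat_trace (ket_bra \<psi>) = 1"
  using assms cscalar_prod_sum[OF assms(1) assms(1)] by (simp add: mat_trace_def ket_bra_def)

section \<open>Exposed points and overlaps in the convex hull\<close>

context
  fixes N :: nat and V :: "complex mat set" and P :: "complex mat set"
  assumes V: "finite V" "\<And>M. M \<in> V \<Longrightarrow> \<exists>\<chi>. \<chi> \<in> carrier_vec N \<and> \<chi> \<bullet>c \<chi> = 1 \<and> M = ket_bra \<chi>"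
    and P: "P = mat_conv_hull N V"
begin

lemma conv_hull_pure_expect:
  assumes psi: "\<psi> \<in> carrier_vec N" and M: "M = mat N N (\<lambda>(r, c). \<Sum>K\<in>V. complex_of_real (p K) * K $$ (r, c))"
  shows "expect N \<psi> M = (\<Sum>K\<in>V. complex_of_real (p K) * expect N \<psi> K)"
proof -
  have "expect N \<psi> M = (\<Sum>i<N. \<Sum>j<N. \<Sum>K\<in>V. complex_of_real (p K) * (cnj (\<psi> $ i) * K $$ (i, j) * \<psi> $ j))"
    unfolding M by (simp add: expect_def sum_distrib_left sum_distrib_right mult_ac)
  also have "\<dots> = (\<Sum>K\<in>V. complex_of_real (p K) * expect N \<psi> K)"
    unfolding sum_rotate3[of _ V] by (simp add: expect_def sum_distrib_left)
  finally show ?thesis .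
qed

lemma conv_hull_pure_trace:
  assumes M: "M \<in> P"
  shows "mat_trace M = 1" "M \<in> carrier_mat N N"
proof -
  from M obtain p where p: "(\<Sum>K\<in>V. p K) = 1"
    and Mp: "M = mat N N (\<lambda>(r, c). \<Sum>K\<in>V. complex_of_real (p K) * K $$ (r, c))"
    unfolding P mat_conv_hull_def by auto
  have "mat_trace M = (\<Sum>K\<in>V. complex_of_real (p K) * (\<Sum>i<N. K $$ (i, i)))"
    unfolding Mp mat_trace_def by (simp add: sum_distrib_left) (rule sum.swap)
  also have "\<dots> = (\<Sum>K\<in>V. complex_of_real (p K))"
  proof (rule sum.cong)
    fix K assume "K \<in> V"
    then obtain \<chi> where "\<chi> \<in> carrier_vec N" "\<chi> \<bullet>c \<chi> = 1" "K = ket_bra \<chi>" using V by blast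
    then have "(\<Sum>i<N. K $$ (i, i)) = 1"
      using mat_trace_ket_bra[of \<chi> N] by (auto simp: mat_trace_def ket_bra_def)
    then show "complex_of_real (p K) * (\<Sum>i<N. K $$ (i, i)) = complex_of_real (p K)" by simp
  qed simp
  also have "\<dots> = 1" using p by (metis of_real_1 of_real_sum)
  finally show "mat_trace M = 1" .
  show "M \<in> carrier_mat N N" unfolding Mp by simp
qed

lemma expect_pure_le_1:
  assumes psi: "\<psi> \<in> carrier_vec N" "\<psi> \<bullet>c \<psi> = 1" and K: "K \<in> V"
  shows "Re (expect N \<psi> K) \<le> 1" "Re (expect N \<psi> K) = 1 \<Longrightarrow> K = ket_bra \<psi>"
proof -
  obtain \<chi> where c: "\<chi> \<in> carrier_vec N" "\<chi> \<bullet>c \<chi> = 1" "K = ket_bra \<chi>" using V K by blast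
  have e: "Re (expect N \<psi> K) = (cmod (\<psi> \<bullet>c \<chi>))\<^sup>2" unfolding c(3) expect_ket_bra[OF psi(1) c(1)] by simp
  then show "Re (expect N \<psi> K) \<le> 1" using cmod_overlap_le_1[OF psi c(1,2)] by simp
  show "K = ket_bra \<psi>" if "Re (expect N \<psi> K) = 1"
    using ket_bra_eq_if_overlap_1[OF psi c(1,2)] that e c(3) by simp
qed

text \<open>The expectation is a weighted average of squared overlaps, each at most 1. An average
  equal to 1 forces overlap 1 for every generator of nonzero weight, so each of these is
  \<open>ket_bra \<psi>\<close>.\<close>

lemma expect_conv_hull_le_1:
  assumes psi: "\<psi> \<in> carrier_vec N" "\<psi> \<bullet>c \<psi> = 1" and M: "M \<in> P"
  shows "Re (expect N \<psi> M) \<le> 1" "Re (expect N \<psi> M) = 1 \<Longrightarrow> M = ket_bra \<psi>"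
proof -
  from M obtain p where p: "(\<Sum>K\<in>V. p K) = 1" "\<And>K. K \<in> V \<Longrightarrow> 0 \<le> p K"
    and Mp: "M = mat N N (\<lambda>(r, c). \<Sum>K\<in>V. complex_of_real (p K) * K $$ (r, c))"
    unfolding P mat_conv_hull_def by auto
  have e: "Re (expect N \<psi> M) = (\<Sum>K\<in>V. p K * Re (expect N \<psi> K))"
    unfolding conv_hull_pure_expect[OF psi(1) Mp] by (simp add: Re_sum)
  have "1 - Re (expect N \<psi> M) = (\<Sum>K\<in>V. p K * (1 - Re (expect N \<psi> K)))"
    unfolding e using p by (simp add: algebra_simps sum_subtractf)
  moreover have nonneg: "0 \<le> p K * (1 - Re (expect N \<psi> K))" if "K \<in> V" for K
    using p(2)[OF that] expect_pure_le_1(1)[OF psi that] by simp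
  ultimately have d: "1 - Re (expect N \<psi> M) = (\<Sum>K\<in>V. p K * (1 - Re (expect N \<psi> K)))" by simp
  show "Re (expect N \<psi> M) \<le> 1" using d sum_nonneg[of V "\<lambda>K. p K * (1 - Re (expect N \<psi> K))"] nonneg by simp
  show "M = ket_bra \<psi>" if 1: "Re (expect N \<psi> M) = 1"
  proof -
    have z: "p K = 0 \<or> K = ket_bra \<psi>" if "K \<in> V" for K
    proof -
      have "\<forall>K\<in>V. p K * (1 - Re (expect N \<psi> K)) = 0"
        using d 1 sum_nonneg_eq_0_iff[OF V(1) nonneg] by simp
      then show ?thesis using expect_pure_le_1(2)[OF psi that] that by auto
    qed
    show ?thesis
    proof (rule eq_matI)
      fix i j assume "i < dim_row (ket_bra \<psi>)" "j < dim_col (ket_bra \<psi>)"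
      then have ij: "i < N" "j < N" using psi by (auto simp: ket_bra_def)
      have "M $$ (i, j) = (\<Sum>K\<in>V. complex_of_real (p K) * K $$ (i, j))" using ij by (simp add: Mp)
      also have "\<dots> = (\<Sum>K\<in>V. complex_of_real (p K) * ket_bra \<psi> $$ (i, j))"
        using z by (intro sum.cong) auto
      also have "\<dots> = ket_bra \<psi> $$ (i, j)"
        unfolding sum_distrib_right[symmetric] of_real_sum[symmetric] p by simp
      finally show "M $$ (i, j) = ket_bra \<psi> $$ (i, j)" .
    qed (use psi in \<open>auto simp: Mp ket_bra_def\<close>)
  qed
qed

lemma generator_in_conv_hull:
  assumes K: "K \<in> V"
  shows "K \<in> P"
proof -
  have c: "K \<in> carrier_mat N N" using V(2)[OF K] by (auto simp: ket_bra_def)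
  have "K = mat N N (\<lambda>(r, c). \<Sum>M\<in>V. complex_of_real (if M = K then 1 else 0) * M $$ (r, c))"
  proof (rule eq_matI; simp)
    fix i j
    have "(\<Sum>M\<in>V. complex_of_real (if M = K then 1 else 0) * M $$ (i, j)) = (\<Sum>M\<in>V. if M = K then K $$ (i, j) else 0)"
      by (intro sum.cong) auto
    then show "K $$ (i, j) = (\<Sum>M\<in>V. complex_of_real (if M = K then 1 else 0) * M $$ (i, j))"
      using V(1) K by simp
  qed (use c in auto)
  then show ?thesis
    unfolding P mat_conv_hull_def using V(1) K
    by (intro CollectI exI[of _ "\<lambda>M. if M = K then 1 else 0"]) auto
qed

text \<open>The expectation in \<open>\<psi>\<close> is a linear functional that attains its maximum
  1 over \<open>P\<close> only at \<open>ket_bra \<psi>\<close>. In a proper convex combination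
  equal to this point, both ends must attain that maximum.\<close>

lemma pure_generator_is_vertex:
  assumes psi: "\<psi> \<in> carrier_vec N" "\<psi> \<bullet>c \<psi> = 1" and K: "ket_bra \<psi> \<in> V"
  shows "is_vertex (ket_bra \<psi>) P"
  unfolding is_vertex_def
proof (intro conjI notI generator_in_conv_hull[OF K])
  assume "\<exists>X\<in>P. \<exists>Y\<in>P. \<exists>t. X \<noteq> Y \<and> 0 < t \<and> t < 1 \<and>
    ket_bra \<psi> = complex_of_real (1 - t) \<cdot>\<^sub>m X + complex_of_real t \<cdot>\<^sub>m Y"
  then obtain X Y t where XY: "X \<in> P" "Y \<in> P" "X \<noteq> Y" and t: "0 < t" "t < 1"
    and eq: "ket_bra \<psi> = complex_of_real (1 - t) \<cdot>\<^sub>m X + complex_of_real t \<cdot>\<^sub>m Y" by blast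
  have c: "X \<in> carrier_mat N N" "Y \<in> carrier_mat N N" using XY conv_hull_pure_trace(2) by auto
  have lin: "expect N \<psi> (ket_bra \<psi>) = complex_of_real (1 - t) * expect N \<psi> X + complex_of_real t * expect N \<psi> Y"
    unfolding eq by (rule expect_lincomb[OF c])
  have "expect N \<psi> (ket_bra \<psi>) = 1" using expect_ket_bra[OF psi(1) psi(1)] psi by simp
  then have "(1 - t) * Re (expect N \<psi> X) + t * Re (expect N \<psi> Y) = 1"
    using arg_cong[OF lin, of Re] by (simp del: of_real_diff)
  then have s: "(1 - t) * (1 - Re (expect N \<psi> X)) + t * (1 - Re (expect N \<psi> Y)) = 0"
    by (simp add: algebra_simps)
  have "0 \<le> (1 - t) * (1 - Re (expect N \<psi> X))" "0 \<le> t * (1 - Re (expect N \<psi> Y))"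
    using expect_conv_hull_le_1(1)[OF psi XY(1)] expect_conv_hull_le_1(1)[OF psi XY(2)] t by auto
  with s have "(1 - t) * (1 - Re (expect N \<psi> X)) = 0" "t * (1 - Re (expect N \<psi> Y)) = 0" by linarith+
  then have "X = ket_bra \<psi>" "Y = ket_bra \<psi>"
    using t expect_conv_hull_le_1(2)[OF psi XY(1)] expect_conv_hull_le_1(2)[OF psi XY(2)] by auto
  then show False using XY by simp
qed

text \<open>The generator of largest overlap serves: every state in \<open>P\<close> has an
  expectation that averages those of the generators, hence is no larger. The resulting lower bound
  on each trace distance passes to the infimum.\<close>

lemma ex_generator_overlap_ge:
  assumes psi: "\<psi> \<in> carrier_vec N" "\<psi> \<bullet>c \<psi> = 1" and V0: "V \<noteq> {}"
  shows "\<exists>K\<in>V. 1 - dist_to P (ket_bra \<psi>) \<le> Re (expect N \<psi> K)"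
proof -
  obtain K where K: "K \<in> V" "\<And>M. M \<in> V \<Longrightarrow> Re (expect N \<psi> M) \<le> Re (expect N \<psi> K)"
  proof -
    have "Max ((\<lambda>M. Re (expect N \<psi> M)) ` V) \<in> (\<lambda>M. Re (expect N \<psi> M)) ` V"
      using V(1) V0 by (intro Max_in) auto
    then obtain K where "K \<in> V" "Re (expect N \<psi> K) = Max ((\<lambda>M. Re (expect N \<psi> M)) ` V)" by auto
    then show ?thesis using V(1) by (intro that[of K]) auto
  qed
  have "1 - Re (expect N \<psi> K) \<le> dist_to P (ket_bra \<psi>)"
    unfolding dist_to_def
  proof (rule cINF_greatest)
    show "P \<noteq> {}" using generator_in_conv_hull[OF K(1)] by auto
    fix \<sigma> assume s: "\<sigma> \<in> P"
    then obtain p where p: "(\<Sum>K\<in>V. p K) = 1" "\<And>K. K \<in> V \<Longrightarrow> 0 \<le> p K"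
      and sp: "\<sigma> = mat N N (\<lambda>(r, c). \<Sum>K\<in>V. complex_of_real (p K) * K $$ (r, c))"
      unfolding P mat_conv_hull_def by auto
    have "Re (expect N \<psi> \<sigma>) = (\<Sum>M\<in>V. p M * Re (expect N \<psi> M))"
      unfolding conv_hull_pure_expect[OF psi(1) sp] by (simp add: Re_sum)
    also have "\<dots> \<le> (\<Sum>M\<in>V. p M * Re (expect N \<psi> K))"
      using p K by (intro sum_mono mult_left_mono) auto
    also have "\<dots> = Re (expect N \<psi> K)" unfolding sum_distrib_right[symmetric] p by simp
    finally show "1 - Re (expect N \<psi> K) \<le> trace_dist (ket_bra \<psi>) \<sigma>"
      using trace_dist_ge[OF psi conv_hull_pure_trace(2)[OF s] conv_hull_pure_trace(1)[OF s]] by linarith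
  qed
  then show ?thesis using K(1) by (intro bexI[of _ K]) auto
qed

end

section \<open>Entropy comparison with a nearby vertex\<close>

theorem corollaryV3:
  fixes d n m :: nat
    and \<phi> :: "nat \<Rightarrow> complex vec"
    and P :: "complex mat set"
  assumes "prime d" and "1 \<le> n" and "1 \<le> m"
    and "\<And>j. j \<in> {1..m} \<Longrightarrow> \<phi> j \<in> carrier_vec (d ^ n) \<and> \<phi> j \<bullet>c \<phi> j = 1"
    and "P = mat_conv_hull (d ^ n) ((\<lambda>j. ket_bra (\<phi> j)) ` {1..m})"
  shows "\<exists>\<epsilon>\<^sub>0>0. \<forall>\<psi> \<epsilon> \<delta>.
    \<psi> \<in> carrier_vec (d ^ n) \<longrightarrow> \<psi> \<bullet>c \<psi> = 1 \<longrightarrow>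
    \<epsilon> = dist_to P (ket_bra \<psi>) \<longrightarrow> \<epsilon> \<le> \<epsilon>\<^sub>0 \<longrightarrow>
    \<delta> = \<epsilon> + 2 * sqrt (1 - binary_entropy_inv (fannes_error \<epsilon> (real (d ^ n)))) \<longrightarrow>
      fannes_error \<epsilon> (real (d ^ n)) \<in> {0..1} \<and> \<delta> \<in> {0..1} \<and>
      (\<forall>A \<subseteq> {1..n}. \<exists>j\<in>{1..m}. is_vertex (ket_bra (\<phi> j)) P \<and>
        \<bar>vN_entropy (reduced_op d n A (ket_bra \<psi>)) -
         vN_entropy (reduced_op d n A (ket_bra (\<phi> j)))\<bar> \<le> fannes_error \<delta> (real (d ^ n)))"
proof -
  let ?N = "d ^ n" let ?V = "(\<lambda>j. ket_bra (\<phi> j)) ` {1..m}"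
  have d: "2 \<le> d" using assms(1) by (rule prime_ge_2_nat)
  \<comment> \<open>The threshold requires dimension at least 2, which makes the logarithm in the
    Fannes error nonnegative.\<close>
  have "d ^ 1 \<le> d ^ n" using assms(2) d by (intro power_increasing) auto
  then have "2 \<le> d ^ n" using d by simp
  then have "2 \<le> real (d ^ n)" by linarith
  then obtain \<epsilon>\<^sub>0 where e0: "0 < \<epsilon>\<^sub>0" "\<epsilon>\<^sub>0 \<le> 1"
    and thr: "\<And>\<epsilon> \<delta>. 0 \<le> \<epsilon> \<Longrightarrow> \<epsilon> \<le> \<epsilon>\<^sub>0 \<Longrightarrow>
      \<delta> = \<epsilon> + 2 * sqrt (1 - binary_entropy_inv (fannes_error \<epsilon> (real (d ^ n)))) \<Longrightarrow>
      fannes_error \<epsilon> (real (d ^ n)) \<in> {0..1} \<and> \<delta> \<in> {0..1} \<and>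
      eta (sqrt \<epsilon>) + real (d ^ n) * sqrt \<epsilon> / ln 2 \<le> fannes_error \<delta> (real (d ^ n))"
    using fannes_error_threshold by blast
  have V: "finite ?V" "\<And>M. M \<in> ?V \<Longrightarrow> \<exists>\<chi>. \<chi> \<in> carrier_vec ?N \<and> \<chi> \<bullet>c \<chi> = 1 \<and> M = ket_bra \<chi>"
    using assms(4) by blast+
  have "fannes_error \<epsilon> (real (d ^ n)) \<in> {0..1} \<and> \<delta> \<in> {0..1} \<and>
      (\<forall>A \<subseteq> {1..n}. \<exists>j\<in>{1..m}. is_vertex (ket_bra (\<phi> j)) P \<and>
        \<bar>vN_entropy (reduced_op d n A (ket_bra \<psi>)) -
         vN_entropy (reduced_op d n A (ket_bra (\<phi> j)))\<bar> \<le> fannes_error \<delta> (real (d ^ n)))"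
    if psi: "\<psi> \<in> carrier_vec ?N" "\<psi> \<bullet>c \<psi> = 1" and e: "\<epsilon> = dist_to P (ket_bra \<psi>)" "\<epsilon> \<le> \<epsilon>\<^sub>0"
      and del: "\<delta> = \<epsilon> + 2 * sqrt (1 - binary_entropy_inv (fannes_error \<epsilon> (real (d ^ n))))" for \<psi> \<epsilon> \<delta>
  proof -
    \<comment> \<open>The vertex is selected by its overlap with \<open>\<psi>\<close> alone, so the
      same \<open>j\<close> works for every \<open>A\<close>.\<close>
    have "?V \<noteq> {}" using assms(3) by simp
    then obtain j where j: "j \<in> {1..m}" and je: "1 - \<epsilon> \<le> Re (expect ?N \<psi> (ket_bra (\<phi> j)))"
      using ex_generator_overlap_ge[OF V assms(5) psi] e(1) by auto
    have phi: "\<phi> j \<in> carrier_vec ?N" "\<phi> j \<bullet>c \<phi> j = 1" using assms(4)[OF j] by auto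
    have ov: "1 - \<epsilon> \<le> (cmod (\<psi> \<bullet>c \<phi> j))\<^sup>2"
      using je unfolding expect_ket_bra[OF psi(1) phi(1)] by simp
    have ov1: "(cmod (\<psi> \<bullet>c \<phi> j))\<^sup>2 \<le> 1" by (rule cmod_overlap_le_1[OF psi phi])
    have eps: "0 \<le> \<epsilon>" using ov ov1 by simp
    note thr = thr[OF eps e(2) del]
    have "\<bar>vN_entropy (reduced_op d n A (ket_bra \<psi>)) - vN_entropy (reduced_op d n A (ket_bra (\<phi> j)))\<bar>
        \<le> eta (sqrt \<epsilon>) + real (d ^ n) * sqrt \<epsilon> / ln 2" if A: "A \<subseteq> {1..n}" for A
    \<comment> \<open>The continuity estimate needs \<open>sqrt \<epsilon>\<close> positive. At
      distance 0 the overlap is 1 and the two states coincide.\<close>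
    proof (cases "\<epsilon> = 0")
      case True
      then have "ket_bra \<psi> = ket_bra (\<phi> j)"
        using ov ov1 by (intro ket_bra_eq_if_overlap_1[OF psi phi]) simp
      then show ?thesis using True by simp
    next
      case False
      then show ?thesis
        using eps e e0 d ov by (intro vN_entropy_reduced_diff_le[OF A _ psi phi]) auto
    qed
    moreover have "is_vertex (ket_bra (\<phi> j)) P"
      using j by (intro pure_generator_is_vertex[OF V assms(5) phi]) auto
    ultimately show ?thesis using thr j by (meson order_trans)
  qed
  then show ?thesis using e0 by blast
qed

end
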